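(* Let $G$ be a finite abelian group of order $v$ and suppose there exists a $(v,m,k,\lambda)$-SEDF in $G$. Let $p$ and $q$ be primes such that $p^d\,\|\,v$ and $q^f\,\|\,\lambda$ for some positive integers $d$ and $f$, and suppose $q$ is a primitive root modulo $p^d$. Let $G_p$ be the Sylow $p$-subgroup of $G$. Then $\exp(G_p)\le v/q^{\lceil f/2\rceil}$.
   Context: Groups are finite abelian, written multiplicatively with identity $1$. For a subset $A\subseteq G$ we also write $A$ for $\sum_{a\in A}a\in\mathbb{Z}[G]$ and $A^{(-1)}=\sum_{a\in A}a^{-1}$. Given integers $m\ge 2$, $k\ge1$, $\lambda\ge 1$ and a group $G$ of order $v$, a collection $\{D_1,\dots,D_m\}$ of mutually disjoint $k$-subsets of $G$ is a $(v,m,k,\lambda)$-strong external difference family (SEDF) in $G$ if $D_j\sum_{i\ne j}D_i^{(-1)}=\lambda(G-1)$ in $\mathbb{Z}[G]$ for each $j$. $x^a\,\|\,y$ means $x^a\mid y$ and $x^{a+1}\nmid y$. A prime $q$ is a primitive root modulo $n$ if it generates the multiplicative group of integers modulo $n$. $\exp$ denotes the exponent of a group. *)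

theory Defs
  imports
    "HOL-Algebra.Sylow"
    "HOL-Number_Theory.Residue_Primitive_Roots"
    "HOL-Library.Disjoint_Sets"
begin

(* An element of the integral group ring of a finite group G is represented by its coefficient
   function, which vanishes outside the carrier of G.  Sums and integer multiples are
   therefore pointwise, and the product is convolution. *)

type_synonym 'a group_ring = "'a \<Rightarrow> int"

definition gr_of :: "'a \<Rightarrow> 'a group_ring" where
  "gr_of a = (\<lambda>x. if x = a then 1 else 0)"

definition gr_set :: "'a set \<Rightarrow> 'a group_ring" where
  "gr_set A = (\<lambda>x. \<Sum>a\<in>A. gr_of a x)"

definition gr_set_inv :: "('a, 'b) monoid_scheme \<Rightarrow> 'a set \<Rightarrow> 'a group_ring" where
  "gr_set_inv G A = (\<lambda>x. \<Sum>a\<in>A. gr_of (inv\<^bsub>G\<^esub> a) x)"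

definition gr_mult ::
    "('a, 'b) monoid_scheme \<Rightarrow> 'a group_ring \<Rightarrow> 'a group_ring \<Rightarrow> 'a group_ring" where
  "gr_mult G f g =
    (\<lambda>x. \<Sum>(y, z) \<in> {(y, z). y \<in> carrier G \<and> z \<in> carrier G \<and> y \<otimes>\<^bsub>G\<^esub> z = x}. f y * g z)"

definition SEDF ::
    "('a, 'b) monoid_scheme \<Rightarrow> nat \<Rightarrow> nat \<Rightarrow> nat \<Rightarrow> nat \<Rightarrow> (nat \<Rightarrow> 'a set) \<Rightarrow> bool" where
  "SEDF G v m k l D \<longleftrightarrow>
     comm_group G \<and> finite (carrier G) \<and> order G = v \<and>
     m \<ge> 2 \<and> k \<ge> 1 \<and> l \<ge> 1 \<and>
     (\<forall>i\<in>{1..m}. D i \<subseteq> carrier G \<and> card (D i) = k) \<and>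
     disjoint_family_on D {1..m} \<and>
     (\<forall>j\<in>{1..m}.
        gr_mult G (gr_set (D j)) (\<lambda>x. \<Sum>i\<in>{1..m} - {j}. gr_set_inv G (D i) x) =
        (\<lambda>x. int l * (gr_set (carrier G) x - gr_of \<one>\<^bsub>G\<^esub> x)))"

definition exactly_divides :: "nat \<Rightarrow> nat \<Rightarrow> nat \<Rightarrow> bool" where
  "exactly_divides x a y \<longleftrightarrow> x ^ a dvd y \<and> \<not> x ^ (a + 1) dvd y"

definition sylow_subgroup :: "('a, 'b) monoid_scheme \<Rightarrow> nat \<Rightarrow> 'a set \<Rightarrow> bool" where
  "sylow_subgroup G p P \<longleftrightarrow> subgroup P G \<and> card P = p ^ multiplicity p (order G)"

definition group_exponent :: "('a, 'b) monoid_scheme \<Rightarrow> nat" where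
  "group_exponent G = (LEAST n. n > 0 \<and> (\<forall>x\<in>carrier G. x [^]\<^bsub>G\<^esub> n = \<one>\<^bsub>G\<^esub>))"

end

theory Submission
  imports Defs "HOL-Computational_Algebra.Polynomial"
begin

text \<open>
  Let \<open>n = p ^ e\<close> be the exponent of the Sylow subgroup. Some homomorphism maps \<open>G\<close> onto the cyclic
  group of order \<open>n\<close>; composing it with a character of order \<open>n\<close> sends the group ring to
  \<open>\<int>[\<zeta>] = \<int>[X] / Phi\<close>, where \<open>Phi\<close> is the \<open>n\<close>-th cyclotomic polynomial, and sends the defining
  equation of the family for \<open>j = 1\<close> to \<open>A * B = - \<lambda>\<close>. Since \<open>q\<close> is a primitive root
  modulo \<open>n\<close>, it stays prime in \<open>\<int>[\<zeta>]\<close>, so \<open>q ^ \<lceil>f / 2\<rceil>\<close> divides \<open>A\<close> or \<open>B\<close>. Both are images of elements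
  with coefficients 0 and 1, so their coefficients on the cyclic group lie between 0 and \<open>v / n\<close>. If
  \<open>v / n < q ^ \<lceil>f / 2\<rceil>\<close>, this divisibility forces \<open>A = 0\<close> or \<open>B = 0\<close>, which is absurd.

  No complex characters are needed: everything takes place in \<open>\<int>[X]\<close> modulo \<open>Phi\<close>, and
  irreducibility of \<open>Phi\<close> over the rationals is not used.
\<close>

(* Coset.order is the group order of the theorem; Polynomial.order would shadow it. *)
hide_const (open) Polynomial.order

section \<open>Congruence modulo an ideal with two generators\<close>

text \<open>One relation serves three purposes on plain polynomials: \<open>a = 0\<close> gives
  computation modulo \<open>Phi\<close>, \<open>b = 0\<close> computation modulo \<open>q\<close>,
  and both generators together the residue ring of \<open>\<int>[X] / Phi\<close> modulo
  \<open>q\<close>.\<close>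

definition cong2 :: "'r::comm_ring_1 \<Rightarrow> 'r \<Rightarrow> 'r \<Rightarrow> 'r \<Rightarrow> bool" where
  "cong2 a b x y \<longleftrightarrow> (\<exists>u w. x - y = a * u + b * w)"

lemma cong2_refl [simp, intro]: "cong2 a b x x"
  unfolding cong2_def by (rule exI[of _ 0], rule exI[of _ 0]) simp

lemma cong2_sym: "cong2 a b x y \<Longrightarrow> cong2 a b y x"
  unfolding cong2_def
proof (elim exE)
  fix u w assume "x - y = a * u + b * w"
  then have "y - x = a * (- u) + b * (- w)" by (simp add: algebra_simps)
  then show "\<exists>u w. y - x = a * u + b * w" by blast
qed

lemma cong2_add: "cong2 a b x y \<Longrightarrow> cong2 a b x' y' \<Longrightarrow> cong2 a b (x + x') (y + y')"
  unfolding cong2_def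
proof (elim exE)
  fix u w u' w' assume "x - y = a * u + b * w" "x' - y' = a * u' + b * w'"
  then have "x + x' - (y + y') = a * (u + u') + b * (w + w')" by (simp add: algebra_simps)
  then show "\<exists>u w. x + x' - (y + y') = a * u + b * w" by blast
qed

lemma cong2_trans [trans]: "cong2 a b x y \<Longrightarrow> cong2 a b y z \<Longrightarrow> cong2 a b x z"
  using cong2_add[of a b x y y z] by (simp add: cong2_def)

lemma cong2_mult_left: "cong2 a b x y \<Longrightarrow> cong2 a b (z * x) (z * y)"
  unfolding cong2_def
proof (elim exE)
  fix u w assume "x - y = a * u + b * w"
  then have "z * (x - y) = z * (a * u + b * w)" by simp
  then have "z * x - z * y = a * (z * u) + b * (z * w)" by (simp add: algebra_simps)
  then show "\<exists>u w. z * x - z * y = a * u + b * w" by blast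
qed

lemma cong2_mult: "cong2 a b x y \<Longrightarrow> cong2 a b x' y' \<Longrightarrow> cong2 a b (x * x') (y * y')"
  using cong2_trans[of a b "x * x'" "x' * y" "y * y'"]
    cong2_mult_left[of a b x y x'] cong2_mult_left[of a b x' y' y]
  by (simp add: mult.commute)

lemma cong2_diff: "cong2 a b x y \<Longrightarrow> cong2 a b x' y' \<Longrightarrow> cong2 a b (x - x') (y - y')"
  using cong2_add[of a b x y "- x'" "- y'"] cong2_mult_left[of a b x' y' "- 1"] by simp

lemma cong2_power: "cong2 a b x y \<Longrightarrow> cong2 a b (x ^ k) (y ^ k)"
  by (induction k) (auto intro: cong2_mult)

lemma cong2_sum: "(\<And>i. i \<in> I \<Longrightarrow> cong2 a b (F i) (H i)) \<Longrightarrow> cong2 a b (sum F I) (sum H I)"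
  by (induction I rule: infinite_finite_induct) (auto intro: cong2_add)

lemma cong2_prod: "(\<And>i. i \<in> I \<Longrightarrow> cong2 a b (F i) (H i)) \<Longrightarrow> cong2 a b (prod F I) (prod H I)"
  by (induction I rule: infinite_finite_induct) (auto intro: cong2_mult)

lemma cong2_0_left_iff: "cong2 0 b x y \<longleftrightarrow> b dvd x - y"
  by (auto simp: cong2_def dvd_def)

lemma cong2_0_right_iff: "cong2 a 0 x y \<longleftrightarrow> a dvd x - y"
  by (auto simp: cong2_def dvd_def)

lemma cong2_weaken_left: "cong2 0 b x y \<Longrightarrow> cong2 a b x y"
  unfolding cong2_def by (metis mult_zero_left mult_zero_right)

lemma cong2_weaken_right: "cong2 a 0 x y \<Longrightarrow> cong2 a b x y"
  unfolding cong2_def by (metis mult_zero_left mult_zero_right)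

section \<open>Substituting a power of the variable, and the Frobenius map modulo a prime\<close>

abbreviation X_pow :: "nat \<Rightarrow> int poly" where
  "X_pow k \<equiv> monom 1 k"

text \<open>For \<open>k\<close> prime to \<open>n\<close> this represents the Galois automorphism
  sending an \<open>n\<close>-th root of unity to its \<open>k\<close>-th power.\<close>

definition subst_pow :: "nat \<Rightarrow> int poly \<Rightarrow> int poly" where
  "subst_pow k A = pcompose A (X_pow k)"

lemma subst_pow_0 [simp]: "subst_pow k 0 = 0"
  by (simp add: subst_pow_def)

lemma subst_pow_pCons: "subst_pow k (pCons a A) = [:a:] + X_pow k * subst_pow k A"
  by (simp add: subst_pow_def pcompose_pCons)

lemma subst_pow_monom: "subst_pow k (monom a i) = monom a (i * k)"
proof (induction i)
  case 0
  then show ?case by (simp add: subst_pow_def monom_0)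
next
  case (Suc i)
  then show ?case by (simp add: subst_pow_pCons monom_Suc mult_monom add.commute)
qed

lemma subst_pow_subst_pow: "subst_pow k (subst_pow j A) = subst_pow (j * k) A"
  using subst_pow_monom[of k 1 j] by (simp add: subst_pow_def flip: pcompose_assoc)

lemma subst_pow_1 [simp]: "subst_pow (Suc 0) A = A"
  by (simp add: subst_pow_def monom_Suc monom_0)

lemma subst_pow_sum: "subst_pow k (sum F I) = (\<Sum>i\<in>I. subst_pow k (F i))"
  by (simp add: subst_pow_def pcompose_sum)

lemma subst_pow_prod: "subst_pow k (prod F I) = (\<Prod>i\<in>I. subst_pow k (F i))"
  by (simp add: subst_pow_def pcompose_prod)

lemma prime_power_add_cong2:
  fixes x y :: "'r::comm_ring_1"
  assumes "prime q"
  shows "cong2 (of_nat q) 0 ((x + y) ^ q) (x ^ q + y ^ q)"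
proof -
  have q: "0 < q" using assms prime_gt_0_nat by blast
  have split: "{..q} = insert 0 (insert q {0<..<q})" using q by auto
  have "(x + y) ^ q = (\<Sum>k\<le>q. of_nat (q choose k) * x ^ k * y ^ (q - k))"
    by (rule binomial_ring)
  also have "\<dots> = (x ^ q + y ^ q) + (\<Sum>k\<in>{0<..<q}. of_nat (q choose k) * x ^ k * y ^ (q - k))"
    unfolding split using q by (simp add: algebra_simps)
  finally have eq: "(x + y) ^ q - (x ^ q + y ^ q) =
      (\<Sum>k\<in>{0<..<q}. of_nat (q choose k) * x ^ k * y ^ (q - k))" by simp
  have "of_nat q dvd (of_nat (q choose k) :: 'r)" if "k \<in> {0<..<q}" for k
  proof -
    have "q dvd q choose k" using that assms by (intro dvd_choose_prime) auto
    then show ?thesis by (auto simp: dvd_def)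
  qed
  then have "of_nat q dvd (x + y) ^ q - (x ^ q + y ^ q)"
    unfolding eq by (intro dvd_sum) (simp add: mult.assoc)
  then show ?thesis by (simp add: cong2_0_right_iff)
qed

text \<open>Fermat's little theorem: additivity of the \<open>q\<close>-th power modulo
  \<open>q\<close> gives the induction step for natural numbers, and every integer is congruent to
  its residue.\<close>

lemma prime_dvd_power_diff:
  fixes a :: int
  assumes "prime q"
  shows "int q dvd a ^ q - a"
proof -
  have q: "0 < q" using assms prime_gt_0_nat by blast
  have nat: "cong2 (int q) 0 (int k ^ q) (int k)" for k
  proof (induction k)
    case (Suc k)
    have "cong2 (int q) 0 ((int k + 1) ^ q) (int k ^ q + 1 ^ q)"
      using prime_power_add_cong2[OF assms, of "int k" 1] by simp
    also have "cong2 (int q) 0 \<dots> (int k + 1)" by (intro cong2_add Suc) simp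
    finally show ?case by (simp add: add.commute)
  qed (use q in \<open>simp add: power_0_left\<close>)
  have a: "cong2 (int q) 0 a (int (nat (a mod int q)))"
    using q by (simp add: cong2_0_right_iff)
  have "cong2 (int q) 0 (a ^ q) (int (nat (a mod int q)) ^ q)" by (rule cong2_power[OF a])
  also note nat
  also note cong2_sym[OF a]
  finally show ?thesis by (simp add: cong2_0_right_iff)
qed

text \<open>Modulo \<open>q\<close> the \<open>q\<close>-th power is additive and fixes the
  coefficients by Fermat's little theorem, so it affects only the variable.\<close>

lemma prime_power_cong_subst_pow:
  assumes "prime q"
  shows "cong2 (of_nat q) 0 (A ^ q) (subst_pow q A)"
proof (induction A)
  case 0
  then show ?case using assms prime_gt_0_nat by (auto simp: power_0_left)
next
  case (pCons a A)
  have split: "pCons a A = [:a:] + X_pow 1 * A" by (simp add: monom_Suc monom_0)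
  have "int q dvd a ^ q - a" by (rule prime_dvd_power_diff[OF assms])
  then obtain k where "a ^ q - a = int q * k" by (elim dvdE)
  then have "[:a:] ^ q - [:a:] = of_nat q * [:k:]" by (simp add: poly_const_pow of_nat_poly)
  then have "of_nat q dvd [:a:] ^ q - [:a:]" by (metis dvd_triv_left)
  then have a: "cong2 (of_nat q) 0 ([:a:] ^ q) [:a:]" by (simp add: cong2_0_right_iff)
  have "cong2 (of_nat q) 0 (pCons a A ^ q) ([:a:] ^ q + (X_pow 1 * A) ^ q)"
    unfolding split by (rule prime_power_add_cong2[OF assms])
  also have "cong2 (of_nat q) 0 \<dots> ([:a:] + X_pow q * subst_pow q A)"
    unfolding power_mult_distrib using pCons
    by (intro cong2_add a cong2_mult) (auto simp: monom_power)
  finally show ?case by (simp add: subst_pow_pCons)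
qed

lemma prime_power_power_cong_subst_pow:
  assumes "prime q"
  shows "cong2 (of_nat q) 0 (A ^ (q ^ i)) (subst_pow (q ^ i) A)"
proof (induction i)
  case 0
  then show ?case by simp
next
  case (Suc i)
  have "cong2 (of_nat q) 0 ((A ^ (q ^ i)) ^ q) (subst_pow (q ^ i) A ^ q)"
    by (rule cong2_power[OF Suc])
  also have "cong2 (of_nat q) 0 \<dots> (subst_pow q (subst_pow (q ^ i) A))"
    by (rule prime_power_cong_subst_pow[OF assms])
  finally show ?case by (simp add: subst_pow_subst_pow mult.commute flip: power_mult)
qed

section \<open>Sums and products over full periods\<close>

lemma cong2_sum_shift_period:
  fixes F :: "nat \<Rightarrow> 'r::comm_ring_1"
  assumes "\<And>t. cong2 a b (F (t + n)) (F t)"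
  shows "cong2 a b (\<Sum>t<n. F (t + k)) (\<Sum>t<n. F t)"
proof (induction k)
  case (Suc k)
  have "(\<Sum>t<n. F (t + Suc k)) + F k = (\<Sum>t<Suc n. F (t + k))"
    by (subst sum.lessThan_Suc_shift) simp
  then have "(\<Sum>t<n. F (t + Suc k)) = (\<Sum>t<n. F (t + k)) + (F (k + n) - F k)"
    by (simp add: algebra_simps)
  also have "cong2 a b \<dots> ((\<Sum>t<n. F t) + (F k - F k))"
    by (intro cong2_add cong2_diff Suc assms) simp
  finally show ?case by simp
qed simp

text \<open>Factors cannot be cancelled as summands can, so a shift by one exchanges the last factor
  \<open>F (k + n)\<close> for the congruent \<open>F k\<close>.\<close>

lemma cong2_prod_shift_period:
  fixes F :: "nat \<Rightarrow> 'r::comm_ring_1"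
  assumes "\<And>t. cong2 a b (F (t + n)) (F t)" and "n > 0"
  shows "cong2 a b (\<Prod>t<n. F (t + k)) (\<Prod>t<n. F t)"
proof (induction k)
  case (Suc k)
  obtain m where n: "n = Suc m" using assms(2) gr0_conv_Suc by blast
  have "(\<Prod>t<n. F (t + Suc k)) = (\<Prod>t<m. F (t + Suc k)) * F (k + n)"
    by (simp add: n add.commute)
  also have "cong2 a b \<dots> ((\<Prod>t<m. F (t + Suc k)) * F k)"
    by (intro cong2_mult assms) simp
  also have "(\<Prod>t<m. F (t + Suc k)) * F k = (\<Prod>t<n. F (t + k))"
    unfolding n by (subst prod.lessThan_Suc_shift) (simp add: mult.commute)
  also note Suc
  finally show ?case .
qed simp

lemma sum_lessThan_add:
  fixes m n :: nat
  shows "(\<Sum>t<m + n. F t) = (\<Sum>t<m. F t) + (\<Sum>t<n. F (m + t))"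
  by (induction n) (auto simp: add.assoc)

lemma cong2_sum_lessThan_mult_period:
  assumes "\<And>t. cong2 a b (F (t + n)) (F t)"
  shows "cong2 a b (\<Sum>t<k * n. F t) (of_nat k * (\<Sum>t<n. F t))"
proof (induction k)
  case (Suc k)
  have "(\<Sum>t<Suc k * n. F t) = (\<Sum>t<k * n. F t) + (\<Sum>t<n. F (t + k * n))"
    using sum_lessThan_add[of F "k * n" n] by (simp add: add.commute)
  also have "cong2 a b \<dots> (of_nat k * (\<Sum>t<n. F t) + (\<Sum>t<n. F t))"
    by (intro cong2_add Suc cong2_sum_shift_period assms)
  finally show ?case by (simp add: algebra_simps)
qed simp

text \<open>Used with \<open>k = p\<close>, where the first factor on the right is
  \<open>Phi\<close>: coefficients of period \<open>s\<close> give a multiple of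
  \<open>Phi\<close>.\<close>

lemma sum_monom_period:
  assumes "\<And>i. c (i + s) = (c i :: int)"
  shows "(\<Sum>i<k * s. monom (c i) i) = (\<Sum>j<k. X_pow (s * j)) * (\<Sum>i<s. monom (c i) i)"
proof (induction k)
  case (Suc k)
  have c: "c (i + j * s) = c i" for i j
    by (induction j) (use assms in \<open>auto simp: add.assoc[symmetric] add.commute[of s]\<close>)
  have "(\<Sum>i<Suc k * s. monom (c i) i) =
      (\<Sum>i<k * s. monom (c i) i) + (\<Sum>i<s. monom (c (k * s + i)) (k * s + i))"
    using sum_lessThan_add[of "\<lambda>i. monom (c i) i" "k * s" s] by (simp add: add.commute)
  also have "(\<Sum>i<s. monom (c (k * s + i)) (k * s + i)) = X_pow (s * k) * (\<Sum>i<s. monom (c i) i)"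
    using c by (simp add: sum_distrib_left mult_monom add.commute mult.commute)
  finally show ?case using Suc by (simp add: algebra_simps)
qed simp

section \<open>The cyclotomic polynomial of a prime power\<close>

locale prime_power_cyclotomic =
  fixes p a :: nat
  assumes prime_p: "prime p"
begin

text \<open>The exponent of \<open>p\<close> in \<open>n\<close> is \<open>Suc a\<close>, so that
  \<open>n\<close> is never 1 and \<open>s\<close> is \<open>n / p\<close>.\<close>

definition s :: nat where "s = p ^ a"
definition n :: nat where "n = p * s"
text \<open>This is (X^n - 1) / (X^s - 1), the \<open>n\<close>-th cyclotomic polynomial.\<close>

definition Phi :: "int poly" where "Phi = (\<Sum>j<p. X_pow (s * j))"

abbreviation eqv :: "int poly \<Rightarrow> int poly \<Rightarrow> bool" (infix "\<sim>" 50) where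
  "A \<sim> B \<equiv> cong2 0 Phi A B"

lemma n_eq: "n = p ^ Suc a"
  by (simp add: n_def s_def)

lemma p_gt_1: "1 < p"
  using prime_p prime_gt_1_nat by blast

lemma s_pos: "0 < s"
  using p_gt_1 by (simp add: s_def)

lemma n_gt_1: "1 < n"
  unfolding n_eq using p_gt_1 by (rule one_less_power) simp

lemma Phi_monic: "degree Phi = n - s" "coeff Phi (n - s) = 1"
proof -
  define A :: "int poly" where "A = (\<Sum>j<p - 1. X_pow (s * j))"
  have Phi: "Phi = A + X_pow (n - s)"
  proof -
    have "p = Suc (p - 1)" using p_gt_1 by simp
    then have "Phi = A + X_pow (s * (p - 1))"
      unfolding Phi_def A_def by (metis sum.lessThan_Suc)
    then show ?thesis by (simp add: n_def diff_mult_distrib2 mult.commute)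
  qed
  have ns: "n - s = s * (p - 1)" by (simp add: n_def diff_mult_distrib2 mult.commute)
  have A: "coeff A i = 0" if "i \<ge> n - s" for i
    unfolding A_def coeff_sum using that s_pos by (intro sum.neutral) (auto simp: ns)
  show c: "coeff Phi (n - s) = 1" by (simp add: Phi A)
  have "degree Phi \<le> n - s"
    by (rule degree_le) (simp add: Phi A)
  moreover have "n - s \<le> degree Phi" using c by (intro le_degree) simp
  ultimately show "degree Phi = n - s" by simp
qed

lemma degree_Phi_pos: "0 < degree Phi"
  using Phi_monic(1) s_pos p_gt_1 by (simp add: n_def)

lemma Phi_ne_0: "Phi \<noteq> 0"
  using degree_Phi_pos by auto

lemma eqv_0_degree_less: "A \<sim> 0 \<Longrightarrow> degree A < degree Phi \<Longrightarrow> A = 0"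
  using dvd_imp_degree_le[of Phi A] by (force simp: cong2_0_left_iff)

text \<open>As \<open>Phi\<close> is monic, pseudo-division involves no scaling and is division with
  remainder over the integers.\<close>

lemma eqv_reduce: "\<exists>r. A \<sim> r \<and> degree r < degree Phi"
proof -
  obtain q r where qr: "pseudo_divmod A Phi = (q, r)" by force
  have "A = Phi * q + r" using pseudo_divmod(1)[OF Phi_ne_0 qr] Phi_monic by simp
  then have "A \<sim> r" by (simp add: cong2_0_left_iff)
  moreover have "degree r < degree Phi"
    using pseudo_divmod(2)[OF Phi_ne_0 qr] degree_Phi_pos by auto
  ultimately show ?thesis by blast
qed

text \<open>The quotient by \<open>Phi\<close> is torsion-free: scaling a reduced representative by
  \<open>c\<close> keeps its degree below that of \<open>Phi\<close>, where only 0 is congruent to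
  0.\<close>

lemma eqv_cancel:
  assumes "of_int c * A \<sim> 0" and "c \<noteq> 0"
  shows "A \<sim> 0"
proof -
  obtain r where r: "A \<sim> r" "degree r < degree Phi" using eqv_reduce by blast
  have "of_int c * r \<sim> 0"
    using assms(1) cong2_trans[OF cong2_sym[OF cong2_mult_left[OF r(1)]]] by blast
  then have "of_int c * r = 0" using r(2) by (intro eqv_0_degree_less) (auto simp: of_int_poly)
  then show ?thesis using r(1) assms(2) by simp
qed

text \<open>For the reduced representative \<open>r\<close> of \<open>A\<close>, the congruence
  becomes the equality \<open>of_int c * r = [:C:]\<close>, so \<open>r\<close> is constant. This
  later removes the factors \<open>p * p\<close> and \<open>totient n\<close> from the norm.\<close>

lemma eqv_const_cancel:
  assumes "of_int c * A \<sim> [:C:]" and "c \<noteq> 0"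
  shows "\<exists>C'. A \<sim> [:C':]"
proof -
  obtain r where r: "A \<sim> r" "degree r < degree Phi" using eqv_reduce by blast
  have "of_int c * r \<sim> [:C:]"
    using assms(1) cong2_trans[OF cong2_sym[OF cong2_mult_left[OF r(1)]]] by blast
  then have "of_int c * r - [:C:] \<sim> 0" by (simp add: cong2_0_left_iff)
  then have "of_int c * r - [:C:] = 0"
    using r(2) degree_Phi_pos by (intro eqv_0_degree_less degree_diff_less) (auto simp: of_int_poly)
  then have "degree (smult c r) = 0" by (simp add: of_int_poly)
  then have "degree r = 0" using assms(2) by simp
  then show ?thesis using r(1) degree_eq_zeroE by metis
qed

lemma X_pow_n: "X_pow n \<sim> 1"
proof -
  have "X_pow n - 1 = X_pow s ^ p - 1" by (simp add: monom_power n_def mult.commute)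
  also have "\<dots> = (X_pow s - 1) * Phi"
    unfolding power_diff_1_eq Phi_def by (simp add: monom_power)
  finally show ?thesis by (simp add: cong2_0_left_iff)
qed

lemma X_pow_cong:
  assumes "[i = j] (mod n)"
  shows "X_pow i \<sim> X_pow j"
proof -
  have red: "X_pow i \<sim> X_pow (i mod n)" for i
  proof -
    have "X_pow i = X_pow n ^ (i div n) * X_pow (i mod n)"
      by (simp add: monom_power mult_monom)
    also have "\<dots> \<sim> 1 ^ (i div n) * X_pow (i mod n)"
      by (intro cong2_mult cong2_power X_pow_n) simp
    finally show ?thesis by simp
  qed
  show ?thesis
    using cong2_trans[OF red[of i] cong2_sym[OF red[of j, folded assms[unfolded cong_def]]]] .
qed

lemma subst_pow_cong:
  assumes "[i = j] (mod n)"
  shows "subst_pow i A \<sim> subst_pow j A"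
  by (induction A) (auto simp: subst_pow_pCons intro!: cong2_add cong2_mult X_pow_cong assms)

text \<open>Up to the factor \<open>p\<close>, the sum below is an integer: if \<open>n\<close> does not divide \<open>i\<close>, some multiple
  of \<open>i\<close> is \<open>s\<close> modulo \<open>n\<close>, so the sum is invariant under multiplication by the \<open>s\<close>-th power of the
  variable and therefore annihilated by \<open>p\<close>.\<close>

lemma sum_X_pow_mult:
  "\<exists>C. of_int (int p) * (\<Sum>t<n. X_pow (i * t)) \<sim> [:C:]"
proof (cases "n dvd i")
  case True
  have "X_pow (i * t) \<sim> 1" for t
    using X_pow_cong[of "i * t" 0] True by (simp add: cong_0_iff)
  then have "of_int (int p) * (\<Sum>t<n. X_pow (i * t)) \<sim> of_int (int p) * (\<Sum>t<n. 1)"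
    by (intro cong2_mult_left cong2_sum)
  also have "\<dots> = [:int (p * n):]" by (simp add: of_nat_poly)
  finally show ?thesis by blast
next
  case False
  let ?f = "\<Sum>t<n. X_pow (i * t)"
  \<comment> \<open>The gcd is a power of \<open>p\<close> other than \<open>n\<close>, hence
    divides \<open>s\<close>; Bezout then supplies the multiplier of \<open>i\<close>.\<close>
  obtain b where b: "b \<le> Suc a" "gcd i n = p ^ b"
    using divides_primepow_nat[OF prime_p, of "gcd i n" "Suc a"] by (auto simp: n_eq)
  then have "b \<noteq> Suc a" using False by (metis gcd_dvd1 n_eq)
  then have "b \<le> a" using b(1) by simp
  then have "gcd i n dvd s" by (simp add: b(2) s_def le_imp_power_dvd)
  then obtain c where c: "s = gcd i n * c" by (elim dvdE)
  obtain x where "[i * x = gcd i n] (mod n)" using cong_solve_nat by blast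
  then have x: "[i * (x * c) = s] (mod n)"
    unfolding c by (metis cong_scalar_right mult.assoc)
  have shift: "X_pow (s * j) * ?f \<sim> ?f" for j
  proof -
    have "[s * j + i * t = i * (t + x * c * j)] (mod n)" for t
    proof -
      have "[s * j + i * t = i * (x * c) * j + i * t] (mod n)"
        by (intro cong_add cong_mult cong_sym[OF x]) auto
      then show ?thesis by (simp add: algebra_simps)
    qed
    then have "X_pow (s * j) * ?f \<sim> (\<Sum>t<n. X_pow (i * (t + x * c * j)))"
      unfolding sum_distrib_left mult_monom by (intro cong2_sum) (simp add: X_pow_cong)
    also have "\<dots> \<sim> ?f"
      by (rule cong2_sum_shift_period, rule X_pow_cong) (simp add: cong_def algebra_simps)
    finally show ?thesis .
  qed
  have "0 \<sim> Phi * ?f" by (simp add: cong2_0_left_iff)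
  also have "\<dots> = (\<Sum>j<p. X_pow (s * j) * ?f)" by (simp add: Phi_def sum_distrib_right)
  also have "\<dots> \<sim> (\<Sum>j<p. ?f)" by (intro cong2_sum shift)
  also have "\<dots> = of_int (int p) * ?f" by simp
  finally show ?thesis using cong2_sym by (metis pCons_0_0)
qed

lemma sum_X_pow_eqv_0: "(\<Sum>i<n. X_pow i) \<sim> 0"
proof -
  have "(\<Sum>i<n. X_pow i) = Phi * (\<Sum>i<s. X_pow i)"
    unfolding n_def Phi_def using sum_monom_period[of "\<lambda>_. 1" s p] by simp
  then show ?thesis by (simp add: cong2_0_left_iff)
qed

end

section \<open>Primitive roots generate inert primes\<close>

text \<open>A totative of \<open>p ^ e\<close> is also one of \<open>p ^ d\<close>, hence a power of
  \<open>q\<close> modulo \<open>p ^ d\<close> and so modulo \<open>p ^ e\<close>. The powers of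
  \<open>q\<close> below its order thus cover all totatives, which forces the order up to the
  totient.\<close>

lemma residue_primroot_prime_power_le:
  assumes "residue_primroot (p ^ d) q" and "prime p" and "0 < e" and "e \<le> d"
  shows "residue_primroot (p ^ e) q"
proof -
  let ?n = "p ^ e"
  have n: "1 < ?n" using prime_gt_1_nat[OF assms(2)] assms(3) by (rule one_less_power)
  have d: "1 < p ^ d" using prime_gt_1_nat[OF assms(2)] assms(3,4) by (intro one_less_power) auto
  have dvd: "?n dvd p ^ d" using assms(4) by (rule le_imp_power_dvd)
  have cop: "coprime ?n q"
    using assms(1) coprime_divisors[OF dvd dvd_refl[of q]] by (simp only: residue_primroot_def)
  have "totatives ?n \<subseteq> (\<lambda>i. q ^ i mod ?n) ` {..<ord ?n q}"
  proof
    fix u assume u: "u \<in> totatives ?n"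
    then have "coprime u p" using assms(3) by (simp add: totatives_def)
    then have "coprime u (p ^ d)" by simp
    moreover have "u < p ^ d"
      using totatives_less[OF u n] dvd_imp_le[OF dvd] d by linarith
    ultimately have "u \<in> totatives (p ^ d)" using u by (simp add: totatives_def)
    then obtain i where "u = q ^ i mod p ^ d"
      using residue_primroot_is_generator[OF d assms(1)] by (auto simp: bij_betw_def)
    then have i: "u = q ^ i mod ?n"
      using dvd totatives_less[OF u n] by (metis mod_less mod_mod_cancel)
    have "[q ^ i = q ^ (i mod ord ?n q)] (mod ?n)"
    proof -
      have "q ^ i = (q ^ ord ?n q) ^ (i div ord ?n q) * q ^ (i mod ord ?n q)"
        by (simp flip: power_mult power_add)
      also have "[\<dots> = 1 ^ (i div ord ?n q) * q ^ (i mod ord ?n q)] (mod ?n)"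
        by (intro cong_mult cong_pow ord cong_refl)
      finally show ?thesis by simp
    qed
    moreover have "i mod ord ?n q < ord ?n q" using cop by simp
    ultimately show "u \<in> (\<lambda>i. q ^ i mod ?n) ` {..<ord ?n q}"
      using i by (auto simp: cong_def)
  qed
  then have "totient ?n \<le> ord ?n q"
    unfolding totient_def by (metis card_lessThan finite_lessThan surj_card_le)
  moreover have "ord ?n q \<le> totient ?n"
    using dvd_imp_le[OF order_divides_totient[OF cop]] prime_gt_0_nat[OF assms(2)] by simp
  ultimately show ?thesis using cop n unfolding residue_primroot_def by linarith
qed

locale inert_prime = prime_power_cyclotomic +
  fixes q :: nat
  assumes prime_q: "prime q" and primroot: "residue_primroot n q"
begin

lemma q_power_totient: "[q ^ (i + totient n) = q ^ i] (mod n)"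
proof -
  have "[q ^ i * q ^ totient n = q ^ i * 1] (mod n)"
    using primroot euler_theorem[of q n]
    by (intro cong_mult) (auto simp: residue_primroot_def coprime_commute)
  then show ?thesis by (simp add: power_add)
qed

text \<open>The exponents \<open>q ^ j\<close> run through the totatives of \<open>n\<close>, that
  is, all residues except the multiples of \<open>p\<close>. This leaves two sums over full periods.
  One factor \<open>p\<close> is the one in \<open>sum_X_pow_mult\<close>, the other extends the
  second sum from length \<open>s\<close> to length \<open>n\<close>.\<close>

lemma sum_orbit_X_pow:
  "\<exists>C. of_int (int (p * p)) * (\<Sum>j<totient n. X_pow (i * q ^ j)) \<sim> [:C:]"
proof -
  let ?T = "\<Sum>j<totient n. X_pow (i * q ^ j)"
  obtain C1 where C1: "of_int (int p) * (\<Sum>t<n. X_pow (i * t)) \<sim> [:C1:]"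
    using sum_X_pow_mult by blast
  obtain C2 where C2: "of_int (int p) * (\<Sum>t<n. X_pow (i * p * t)) \<sim> [:C2:]"
    using sum_X_pow_mult by blast
  have "?T \<sim> (\<Sum>j<totient n. X_pow (i * (q ^ j mod n)))"
    by (intro cong2_sum X_pow_cong cong_mult) (auto simp: cong_def)
  also have "\<dots> = (\<Sum>u\<in>totatives n. X_pow (i * u))"
    by (rule sum.reindex_bij_betw[OF residue_primroot_is_generator[OF n_gt_1 primroot]])
  also have "\<dots> = (\<Sum>u\<in>{0<..n}. X_pow (i * u)) - (\<Sum>u\<in>(*) p ` {0<..s}. X_pow (i * u))"
  proof -
    have "(*) p ` {0<..s} \<subseteq> {0<..n}" using p_gt_1 by (auto simp: n_def)
    then show ?thesis
      using totatives_prime_power_Suc[OF prime_p, of a]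
      by (simp add: n_eq s_def sum_diff)
  qed
  also have "(\<Sum>u\<in>{0<..n}. X_pow (i * u)) = (\<Sum>t<n. X_pow (i * (t + 1)))"
    by (rule sum.reindex_bij_witness[of _ "\<lambda>t. t + 1" "\<lambda>t. t - 1"]) auto
  also have "(\<Sum>u\<in>(*) p ` {0<..s}. X_pow (i * u)) = (\<Sum>u\<in>{0<..s}. X_pow (i * p * u))"
    using p_gt_1 by (subst sum.reindex) (auto simp: inj_on_def mult.assoc)
  also have "(\<Sum>u\<in>{0<..s}. X_pow (i * p * u)) = (\<Sum>t<s. X_pow (i * p * (t + 1)))"
    by (rule sum.reindex_bij_witness[of _ "\<lambda>t. t + 1" "\<lambda>t. t - 1"]) auto
  also have "(\<Sum>t<n. X_pow (i * (t + 1))) - (\<Sum>t<s. X_pow (i * p * (t + 1))) \<sim>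
      (\<Sum>t<n. X_pow (i * t)) - (\<Sum>t<s. X_pow (i * p * t))"
    by (intro cong2_diff cong2_sum_shift_period[of 0 Phi "\<lambda>t. X_pow (i * t)"]
          cong2_sum_shift_period[of 0 Phi "\<lambda>t. X_pow (i * p * t)"] X_pow_cong)
      (auto simp: cong_def n_def algebra_simps)
  finally have T: "?T \<sim> (\<Sum>t<n. X_pow (i * t)) - (\<Sum>t<s. X_pow (i * p * t))" .
  \<comment> \<open>The exponent \<open>i * p * t\<close> has period \<open>s\<close> in
    \<open>t\<close> modulo \<open>n\<close>, so the sum of length \<open>n\<close> consists of
    \<open>p\<close> equal blocks.\<close>
  have S: "of_nat p * (\<Sum>t<s. X_pow (i * p * t)) \<sim> (\<Sum>t<n. X_pow (i * p * t))"
    unfolding n_def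
    by (intro cong2_sym[OF cong2_sum_lessThan_mult_period[of 0 Phi "\<lambda>t. X_pow (i * p * t)"]]
          X_pow_cong) (auto simp: cong_def n_def algebra_simps)
  have "of_int (int (p * p)) * ?T \<sim>
      of_int (int (p * p)) * ((\<Sum>t<n. X_pow (i * t)) - (\<Sum>t<s. X_pow (i * p * t)))"
    by (rule cong2_mult_left[OF T])
  also have "\<dots> = of_int (int p) * (of_int (int p) * (\<Sum>t<n. X_pow (i * t))) -
      of_int (int p) * (of_nat p * (\<Sum>t<s. X_pow (i * p * t)))"
    by (simp add: algebra_simps)
  also have "\<dots> \<sim> of_int (int p) * [:C1:] - of_int (int p) * (\<Sum>t<n. X_pow (i * p * t))"
    by (intro cong2_diff cong2_mult_left S C1)
  also have "\<dots> \<sim> of_int (int p) * [:C1:] - [:C2:]"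
    by (intro cong2_diff C2) simp
  also have "\<dots> = [:int p * C1 - C2:]" by (simp add: of_nat_poly)
  finally show ?thesis by blast
qed

text \<open>The trace of \<open>A\<close> is an integer up to the factor \<open>p * p\<close>, by
  linearity from the monomials.\<close>

lemma sum_orbit:
  "\<exists>C. of_int (int (p * p)) * (\<Sum>j<totient n. subst_pow (q ^ j) A) \<sim> [:C:]"
proof -
  let ?P = "of_int (int (p * p)) :: int poly"
  obtain C where C: "?P * (\<Sum>j<totient n. X_pow (i * q ^ j)) \<sim> [:C i:]" for i
    using sum_orbit_X_pow by metis
  have A: "subst_pow k A = (\<Sum>i\<le>degree A. [:coeff A i:] * X_pow (i * k))" for k
  proof -
    have "subst_pow k A = subst_pow k (\<Sum>i\<le>degree A. monom (coeff A i) i)"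
      by (simp add: poly_as_sum_of_monoms)
    then show ?thesis by (simp add: subst_pow_sum subst_pow_monom smult_monom)
  qed
  have "?P * (\<Sum>j<totient n. subst_pow (q ^ j) A) =
      (\<Sum>i\<le>degree A. [:coeff A i:] * (?P * (\<Sum>j<totient n. X_pow (i * q ^ j))))"
    unfolding A by (subst sum.swap) (simp add: sum_distrib_left mult_ac)
  also have "\<dots> \<sim> (\<Sum>i\<le>degree A. [:coeff A i:] * [:C i:])"
    by (intro cong2_sum cong2_mult_left C)
  also have "\<dots> = [:\<Sum>i\<le>degree A. coeff A i * C i:]"
    by (simp add: sum_to_poly mult.commute)
  finally show ?thesis by blast
qed

text \<open>The norm is fixed by all substitutions, so summing it over the orbit multiplies it by
  \<open>totient n\<close>. That this factor may be divisible by \<open>q\<close> does no harm, because it is cancelled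
  over the integers.\<close>

lemma norm_eqv_const: "\<exists>C. (\<Prod>i<totient n. subst_pow (q ^ i) A) \<sim> [:C:]"
proof -
  let ?N = "\<Prod>i<totient n. subst_pow (q ^ i) A"
  have "subst_pow (q ^ j) ?N \<sim> ?N" for j
  proof -
    have "subst_pow (q ^ j) ?N = (\<Prod>i<totient n. subst_pow (q ^ (i + j)) A)"
      by (simp add: subst_pow_prod subst_pow_subst_pow power_add)
    also have "\<dots> \<sim> ?N"
      using n_gt_1
      by (intro cong2_prod_shift_period[of 0 Phi "\<lambda>i. subst_pow (q ^ i) A"] subst_pow_cong q_power_totient)
        auto
    finally show ?thesis .
  qed
  then have N: "(\<Sum>j<totient n. subst_pow (q ^ j) ?N) \<sim> (\<Sum>j<totient n. ?N)"
    by (intro cong2_sum)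
  obtain C where "of_int (int (p * p)) * (\<Sum>j<totient n. subst_pow (q ^ j) ?N) \<sim> [:C:]"
    using sum_orbit by blast
  then have "of_int (int (p * p)) * (\<Sum>j<totient n. ?N) \<sim> [:C:]"
    using cong2_trans[OF cong2_sym[OF cong2_mult_left[OF N]]] by blast
  then have "of_int (int (p * p * totient n)) * ?N \<sim> [:C:]" by (simp add: mult.assoc)
  moreover have "int (p * p * totient n) \<noteq> 0" using p_gt_1 n_gt_1 by simp
  ultimately show ?thesis by (rule eqv_const_cancel)
qed

text \<open>Modulo \<open>q\<close> the norm of \<open>A\<close> is a power of \<open>A\<close>, with exponent at most \<open>q ^ totient n\<close>, and the
  power with that last exponent is \<open>A\<close> itself. So \<open>A\<close> vanishes if its norm does; otherwise the
  norm, being an integer, is a unit, and so is \<open>A\<close>.\<close>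

lemma inert_mult:
  assumes "cong2 (of_nat q) Phi (A * B) 0"
  shows "cong2 (of_nat q) Phi A 0 \<or> cong2 (of_nat q) Phi B 0"
proof -
  let ?N = "\<Prod>i<totient n. subst_pow (q ^ i) A"
  let ?M = "\<Sum>i<totient n. q ^ i"
  have q: "1 < q" using prime_q prime_gt_1_nat by blast
  obtain C where "?N \<sim> [:C:]" using norm_eqv_const by blast
  then have C: "cong2 (of_nat q) Phi ?N [:C:]" by (rule cong2_weaken_left)
  show ?thesis
  proof (cases "int q dvd C")
    case True
    then obtain k where "C = int q * k" by (elim dvdE)
    then have "[:C:] - 0 = of_nat q * [:k:] + Phi * 0" by (simp add: of_nat_poly)
    then have C0: "cong2 (of_nat q) Phi [:C:] 0" unfolding cong2_def by blast
    have "A ^ ?M = (\<Prod>i<totient n. A ^ (q ^ i))" by (rule power_sum)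
    also have "cong2 (of_nat q) Phi \<dots> ?N"
      by (rule cong2_prod, rule cong2_weaken_right, rule prime_power_power_cong_subst_pow[OF prime_q])
    also note C
    also note C0
    finally have M: "cong2 (of_nat q) Phi (A ^ ?M) 0" .
    \<comment> \<open>By the geometric sum, \<open>(q - 1) * ?M\<close> equals
      \<open>q ^ totient n - 1\<close>.\<close>
    have "1 * ?M \<le> (q - 1) * ?M" using q by (intro mult_le_mono1) linarith
    then have "?M \<le> (q - 1) * ?M" by simp
    also have "\<dots> \<le> q ^ totient n"
    proof -
      have "int ((q - 1) * ?M) = int (q ^ totient n) - 1"
        using q power_diff_1_eq[of "int q" "totient n"] by (simp add: of_nat_diff)
      then show ?thesis by linarith
    qed
    finally have le: "?M \<le> q ^ totient n" .
    have "cong2 (of_nat q) Phi (subst_pow (q ^ 0) A) (subst_pow (q ^ totient n) A)"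
      using q_power_totient[of 0] by (intro cong2_weaken_left[OF subst_pow_cong]) (simp add: cong_sym_eq)
    also have "cong2 (of_nat q) Phi \<dots> (A ^ (q ^ totient n))"
      by (rule cong2_sym[OF cong2_weaken_right[OF prime_power_power_cong_subst_pow[OF prime_q]]])
    also have "A ^ (q ^ totient n) = A ^ (q ^ totient n - ?M) * A ^ ?M"
      using le by (simp flip: power_add)
    also have "cong2 (of_nat q) Phi \<dots> (A ^ (q ^ totient n - ?M) * 0)"
      by (rule cong2_mult_left[OF M])
    finally show ?thesis by simp
  next
    case False
    then have "coprime C (int q)" using prime_q
      by (metis coprime_commute prime_imp_coprime prime_nat_int_transfer)
    then obtain u w where "u * C + w * int q = 1"
      using bezout_int[of C "int q"] by (auto simp: coprime_iff_gcd_eq_1)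
    then have "[:1:] - [:u:] * [:C:] = of_nat q * [:w:] + Phi * 0"
      by (simp add: of_nat_poly algebra_simps)
    then have u: "cong2 (of_nat q) Phi 1 ([:u:] * [:C:])"
      unfolding cong2_def pCons_one by blast
    \<comment> \<open>The factor of the norm for \<open>i = 0\<close> is \<open>A\<close> itself. So
      \<open>B\<close>, congruent to a multiple of the norm times \<open>B\<close>, is congruent to
      a multiple of \<open>A * B\<close>.\<close>
    have tot: "totient n = Suc (totient n - 1)" using n_gt_1 by simp
    define R where "R = (\<Prod>i<totient n - 1. subst_pow (q ^ Suc i) A)"
    have R: "?N = A * R"
      unfolding R_def by (subst tot, subst prod.lessThan_Suc_shift) simp
    have "cong2 (of_nat q) Phi (1 * B) ([:u:] * [:C:] * B)"
      by (rule cong2_mult[OF u cong2_refl])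
    also have "cong2 (of_nat q) Phi \<dots> ([:u:] * ?N * B)"
      by (intro cong2_mult cong2_sym[OF C] cong2_refl)
    also have "[:u:] * ?N * B = [:u:] * R * (A * B)" by (simp add: R mult_ac)
    also have "cong2 (of_nat q) Phi \<dots> ([:u:] * R * 0)"
      by (rule cong2_mult_left[OF assms])
    finally show ?thesis by simp
  qed
qed

text \<open>\<open>A'\<close> is a quotient of \<open>A\<close> by \<open>q\<close> modulo
  \<open>Phi\<close>, and torsion-freeness cancels one \<open>q\<close> from the congruence for
  \<open>A * B\<close>. The claim for all \<open>i\<close> carries any divisibility of
  \<open>A'\<close> back to \<open>A\<close>.\<close>

lemma cong2_power_Suc_cases:
  assumes "cong2 (of_nat q) Phi A 0" and "cong2 (of_nat (q ^ Suc f)) Phi (A * B) 0"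
  shows "\<exists>A'. (\<forall>i. cong2 (of_nat (q ^ i)) Phi A' 0 \<longrightarrow> cong2 (of_nat (q ^ Suc i)) Phi A 0) \<and>
    cong2 (of_nat (q ^ f)) Phi (A' * B) 0"
proof -
  obtain A' V where A: "A = of_nat q * A' + Phi * V" using assms(1) by (auto simp: cong2_def)
  obtain U W where AB: "A * B = of_nat (q ^ Suc f) * U + Phi * W"
    using assms(2) by (auto simp: cong2_def)
  have "of_int (int q) * (A' * B - of_nat (q ^ f) * U) = Phi * (W - V * B)"
    using AB unfolding A by (simp add: algebra_simps)
  then have "of_int (int q) * (A' * B - of_nat (q ^ f) * U) \<sim> 0" by (simp add: cong2_0_left_iff)
  moreover have "int q \<noteq> 0" using prime_q by auto
  ultimately have "A' * B - of_nat (q ^ f) * U \<sim> 0" by (rule eqv_cancel)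
  then obtain Z where "A' * B - of_nat (q ^ f) * U = Phi * Z"
    by (auto simp: cong2_0_left_iff)
  then have "A' * B - 0 = of_nat (q ^ f) * U + Phi * Z" by (simp add: algebra_simps)
  then have AB': "cong2 (of_nat (q ^ f)) Phi (A' * B) 0" unfolding cong2_def by blast
  have "cong2 (of_nat (q ^ Suc i)) Phi A 0" if i: "cong2 (of_nat (q ^ i)) Phi A' 0" for i
  proof -
    obtain U W where A': "A' = of_nat (q ^ i) * U + Phi * W" using i by (auto simp: cong2_def)
    have "A - 0 = of_nat (q ^ Suc i) * U + Phi * (of_nat q * W + V)"
      unfolding A A' by (simp add: algebra_simps)
    then show ?thesis unfolding cong2_def by blast
  qed
  with AB' show ?thesis by blast
qed

text \<open>Since \<open>q\<close> is prime modulo \<open>Phi\<close>, it divides one of the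
  factors; one \<open>q\<close> is split off there and the induction continues with the
  quotient.\<close>

lemma inert_mult_power:
  assumes "cong2 (of_nat (q ^ f)) Phi (A * B) 0"
  shows "\<exists>i j. i + j = f \<and> cong2 (of_nat (q ^ i)) Phi A 0 \<and> cong2 (of_nat (q ^ j)) Phi B 0"
  using assms
proof (induction f arbitrary: A B)
  case 0
  have "cong2 (of_nat (q ^ 0)) Phi X 0" for X
    unfolding cong2_def by (rule exI[of _ X], rule exI[of _ 0]) simp
  then show ?case by blast
next
  case (Suc f)
  obtain U W where "A * B = of_nat (q ^ Suc f) * U + Phi * W"
    using Suc.prems by (auto simp: cong2_def)
  then have "A * B - 0 = of_nat q * (of_nat (q ^ f) * U) + Phi * W" by (simp add: mult.assoc)
  then have "cong2 (of_nat q) Phi (A * B) 0" unfolding cong2_def by blast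
  then consider "cong2 (of_nat q) Phi A 0" | "cong2 (of_nat q) Phi B 0" using inert_mult by blast
  then show ?case
  proof cases
    case 1
    obtain A' where A': "\<And>i. cong2 (of_nat (q ^ i)) Phi A' 0 \<Longrightarrow> cong2 (of_nat (q ^ Suc i)) Phi A 0"
      "cong2 (of_nat (q ^ f)) Phi (A' * B) 0"
      using cong2_power_Suc_cases[OF 1 Suc.prems] by blast
    obtain i j where "i + j = f" "cong2 (of_nat (q ^ i)) Phi A' 0" "cong2 (of_nat (q ^ j)) Phi B 0"
      using Suc.IH[OF A'(2)] by blast
    then show ?thesis using A'(1) by (intro exI[of _ "Suc i"] exI[of _ j]) simp
  next
    case 2
    have prems: "cong2 (of_nat (q ^ Suc f)) Phi (B * A) 0" using Suc.prems by (simp only: mult.commute)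
    obtain B' where B': "\<And>i. cong2 (of_nat (q ^ i)) Phi B' 0 \<Longrightarrow> cong2 (of_nat (q ^ Suc i)) Phi B 0"
      "cong2 (of_nat (q ^ f)) Phi (B' * A) 0"
      using cong2_power_Suc_cases[OF 2 prems] by blast
    have "cong2 (of_nat (q ^ f)) Phi (A * B') 0" using B'(2) by (simp only: mult.commute)
    then obtain i j where "i + j = f" "cong2 (of_nat (q ^ i)) Phi A 0"
      "cong2 (of_nat (q ^ j)) Phi B' 0"
      using Suc.IH by blast
    then show ?thesis using B'(1) by (intro exI[of _ i] exI[of _ "Suc j"]) simp
  qed
qed

end

section \<open>Divisibility of elements with small coefficients\<close>

context prime_power_cyclotomic
begin

text \<open>Replacing each coefficient in the top block of length \<open>s\<close> by subtracting it from the whole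
  residue class modulo \<open>s\<close> reduces the sum below the degree of \<open>Phi\<close>, and the new coefficients
  are differences of two old ones, hence too small to be nonzero multiples of \<open>Q\<close>.\<close>

lemma small_coeffs_eqv_0:
  assumes "\<And>i. 0 \<le> c i \<and> c i \<le> u" and "u < int Q"
    and "cong2 (of_nat Q) Phi (\<Sum>i<n. monom (c i) i) 0"
  shows "(\<Sum>i<n. monom (c i) i) \<sim> 0"
proof -
  \<comment> \<open>The top block of \<open>c\<close>, continued with period \<open>s\<close> over
    all indices; it agrees with \<open>c\<close> on the top block because \<open>s\<close> divides
    \<open>n - s\<close>.\<close>
  define c' where "c' = (\<lambda>i. c (n - s + i mod s))"
  define r where "r = (\<Sum>i<n - s. monom (c i - c' i) i)"
  let ?E = "\<Sum>i<n. monom (c i) i"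
  have split: "{..<n} = {..<n - s} \<union> {n - s..<n}" by auto
  have "c i = c' i" if "i \<in> {n - s..<n}" for i
  proof -
    obtain k where k: "n - s = s * k" by (metis n_def diff_mult_distrib mult_1 mult.commute)
    define j where "j = i - (n - s)"
    have "i = s * k + j" "j < s" using that s_pos by (auto simp: j_def simp flip: k)
    then show ?thesis by (simp add: c'_def k)
  qed
  then have "?E - (\<Sum>i<n. monom (c' i) i) = r"
    unfolding split r_def
    by (subst (1 2) sum.union_disjoint) (auto simp: sum_subtractf simp flip: diff_monom)
  moreover have "(\<Sum>i<n. monom (c' i) i) = Phi * (\<Sum>i<s. monom (c' i) i)"
    unfolding n_def Phi_def by (rule sum_monom_period) (simp add: c'_def)
  ultimately have E: "?E \<sim> r" by (auto simp: cong2_0_left_iff algebra_simps)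
  have coeff_r: "coeff r i = (if i < n - s then c i - c' i else 0)" for i
    by (simp add: r_def coeff_sum coeff_monom)
  have deg_r: "degree r < degree Phi"
    using degree_Phi_pos Phi_monic(1) by (intro degree_lessI) (auto simp: coeff_r)
  obtain U W where UW: "?E = of_nat Q * U + Phi * W" using assms(3) by (auto simp: cong2_def)
  obtain r' where r': "U \<sim> r'" "degree r' < degree Phi" using eqv_reduce by blast
  have "?E - of_nat Q * U \<sim> 0" by (simp add: UW cong2_0_left_iff)
  then have "r - of_nat Q * r' \<sim> 0"
    using cong2_trans[OF cong2_sym[OF cong2_diff[OF E cong2_mult_left[OF r'(1)]]]] by blast
  \<comment> \<open>Both terms are reduced, so the congruence is an equality and every coefficient
    of \<open>r\<close> is a multiple of \<open>Q\<close>.\<close>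
  then have "r - of_nat Q * r' = 0"
    using deg_r r'(2) degree_Phi_pos
    by (intro eqv_0_degree_less degree_diff_less) (auto simp: of_nat_poly intro: le_less_trans[OF degree_smult_le])
  then have r: "r = smult (int Q) r'" by (simp add: of_nat_poly)
  have "coeff r i = 0" for i
  proof (rule ccontr)
    assume "coeff r i \<noteq> 0"
    then have "coeff r' i \<noteq> 0" by (simp add: r)
    then have "int Q * 1 \<le> int Q * \<bar>coeff r' i\<bar>" by (intro mult_left_mono) linarith+
    then have "int Q \<le> \<bar>coeff r i\<bar>" by (simp add: r abs_mult)
    moreover have "\<bar>coeff r i\<bar> \<le> u"
      using assms(1)[of i] assms(1)[of "n - s + i mod s"] by (auto simp: coeff_r c'_def)
    ultimately show False using assms(2) by linarith
  qed
  then have "r = 0" by (simp add: poly_eq_iff)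
  then show ?thesis using E by simp
qed

end

section \<open>Homomorphisms onto cyclic groups\<close>

text \<open>A homomorphism to the integers modulo \<open>n\<close>, written with integer values, on
  a domain that may grow. Inverses are obtained as powers once the exponent divides
  \<open>n\<close>.\<close>

definition (in group) partial_hom :: "nat \<Rightarrow> 'a set \<Rightarrow> ('a \<Rightarrow> int) \<Rightarrow> bool" where
  "partial_hom n H h \<longleftrightarrow> H \<subseteq> carrier G \<and> \<one> \<in> H \<and>
    (\<forall>x\<in>H. \<forall>y\<in>H. x \<otimes> y \<in> H \<and> [h (x \<otimes> y) = h x + h y] (mod int n))"

lemma (in group) partial_hom_one:
  assumes "partial_hom n H h"
  shows "[h \<one> = 0] (mod int n)"
proof -
  have "[h (\<one> \<otimes> \<one>) = h \<one> + h \<one>] (mod int n)"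
    using assms unfolding partial_hom_def by blast
  then show ?thesis by (simp add: cong_iff_dvd_diff)
qed

lemma (in group) partial_hom_pow:
  assumes "partial_hom n H h" and "x \<in> H"
  shows "x [^] (k::nat) \<in> H \<and> [h (x [^] k) = int k * h x] (mod int n)"
proof (induction k)
  case 0
  then show ?case using assms partial_hom_one by (auto simp: partial_hom_def)
next
  case (Suc k)
  then have "[h (x [^] k \<otimes> x) = h (x [^] k) + h x] (mod int n)"
    using assms by (simp add: partial_hom_def)
  also have "[h (x [^] k) + h x = int k * h x + h x] (mod int n)"
    using Suc by (intro cong_add) auto
  finally show ?case using Suc assms by (simp add: partial_hom_def algebra_simps)
qed

text \<open>The extension sends \<open>y \<otimes> x [^] k\<close> to
  \<open>h y + t * int k\<close>. Two representations of one element differ by a power of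
  \<open>x\<close> in \<open>H\<close>, on which \<open>t\<close> agrees with
  \<open>h\<close>.\<close>

lemma (in comm_group) partial_hom_extend:
  assumes H: "partial_hom n H h" and x: "x \<in> carrier G"
    and exp: "\<And>z. z \<in> carrier G \<Longrightarrow> z [^] n = \<one>" and n: "0 < n"
    and t: "\<And>k::nat. x [^] k \<in> H \<Longrightarrow> [h (x [^] k) = t * int k] (mod int n)"
  shows "\<exists>H' h'. partial_hom n H' h' \<and> H \<subseteq> H' \<and> x \<in> H' \<and>
    (\<forall>y\<in>H. [h' y = h y] (mod int n)) \<and> [h' x = t] (mod int n)"
proof -
  have sub: "H \<subseteq> carrier G" and one: "\<one> \<in> H"
    and closed: "\<And>y z. y \<in> H \<Longrightarrow> z \<in> H \<Longrightarrow> y \<otimes> z \<in> H"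
    and hom: "\<And>y z. y \<in> H \<Longrightarrow> z \<in> H \<Longrightarrow> [h (y \<otimes> z) = h y + h z] (mod int n)"
    using H by (auto simp: partial_hom_def)
  define val where "val = (\<lambda>y k. h y + t * int k)"
  have le: "[val y i = val z j] (mod int n)"
    if yz: "y \<in> H" "z \<in> H" and eq: "y \<otimes> x [^] i = z \<otimes> x [^] j" and ij: "i \<le> j" for y z i j
  proof -
    have [simp]: "y \<in> carrier G" "z \<in> carrier G" using yz sub by auto
    have "x [^] j = x [^] (j - i) \<otimes> x [^] i" using ij x by (simp add: nat_pow_mult)
    then have "y \<otimes> x [^] i = (z \<otimes> x [^] (j - i)) \<otimes> x [^] i"
      using eq x by (simp add: m_assoc)
    then have y: "y = z \<otimes> x [^] (j - i)" using x by (simp del: m_assoc)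
    \<comment> \<open>\<open>z [^] (n - 1)\<close> is the inverse of \<open>z\<close>, which lies in
      \<open>H\<close> as a power.\<close>
    have "z [^] (n - 1) \<otimes> z = \<one>"
      using exp[of z] n by (metis Suc_diff_1 nat_pow_Suc \<open>z \<in> carrier G\<close>)
    then have "x [^] (j - i) = z [^] (n - 1) \<otimes> y"
      unfolding y using x by (simp flip: m_assoc)
    then have mem: "x [^] (j - i) \<in> H"
      using partial_hom_pow[OF H yz(2)] closed yz by simp
    have "[h y = h z + h (x [^] (j - i))] (mod int n)"
      using hom[OF yz(2) mem] y by simp
    also have "[h z + h (x [^] (j - i)) = h z + t * int (j - i)] (mod int n)"
      by (intro cong_add t mem) simp
    finally have "[h y + t * int i = h z + t * int (j - i) + t * int i] (mod int n)"
      by (rule cong_add) simp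
    also have "h z + t * int (j - i) + t * int i = h z + t * int j"
      using ij by (simp add: of_nat_diff algebra_simps)
    finally show ?thesis by (simp add: val_def)
  qed
  have wd: "[val y i = val z j] (mod int n)"
    if "y \<in> H" "z \<in> H" "y \<otimes> x [^] i = z \<otimes> x [^] j" for y z i j
    using le[of y z i j] le[of z y j i] that cong_sym by (cases "i \<le> j") auto
  define H' where "H' = {y \<otimes> x [^] (k::nat) |y k. y \<in> H}"
  define h' where "h' = (\<lambda>z. SOME c. \<exists>y (k::nat). y \<in> H \<and> z = y \<otimes> x [^] k \<and> c = val y k)"
  have h': "[h' (y \<otimes> x [^] k) = val y k] (mod int n)" if y: "y \<in> H" for y and k :: nat
  proof -
    have "\<exists>c y' (k'::nat). y' \<in> H \<and> y \<otimes> x [^] k = y' \<otimes> x [^] k' \<and> c = val y' k'"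
      using y by blast
    from someI_ex[OF this] obtain y' and k' :: nat where "y' \<in> H"
      "y \<otimes> x [^] k = y' \<otimes> x [^] k'" "h' (y \<otimes> x [^] k) = val y' k'"
      unfolding h'_def by auto
    then show ?thesis using wd[of y' y k' k] y by simp
  qed
  have prod: "(y \<otimes> x [^] i) \<otimes> (z \<otimes> x [^] j) = (y \<otimes> z) \<otimes> x [^] (i + j)"
    if "y \<in> H" "z \<in> H" for y z and i j :: nat
  proof -
    have "y \<in> carrier G" "z \<in> carrier G" using that sub by auto
    then show ?thesis using x by (simp add: m_ac flip: nat_pow_mult)
  qed
  have "partial_hom n H' h'"
    unfolding partial_hom_def
  proof (intro conjI ballI)
    show "H' \<subseteq> carrier G" using sub x by (auto simp: H'_def)
    have "\<one> = \<one> \<otimes> x [^] (0::nat)" by simp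
    then show "\<one> \<in> H'" using one unfolding H'_def by blast
  next
    fix u w assume "u \<in> H'" "w \<in> H'"
    then obtain y z and i j :: nat where yz: "y \<in> H" "z \<in> H" and uw: "u = y \<otimes> x [^] i" "w = z \<otimes> x [^] j"
      by (auto simp: H'_def)
    have eq: "u \<otimes> w = (y \<otimes> z) \<otimes> x [^] (i + j)" unfolding uw by (rule prod[OF yz])
    show "u \<otimes> w \<in> H'" unfolding eq H'_def using closed[OF yz] by blast
    have "[h' (u \<otimes> w) = val (y \<otimes> z) (i + j)] (mod int n)"
      unfolding eq by (rule h'[OF closed[OF yz]])
    also have "[val (y \<otimes> z) (i + j) = h y + h z + t * int (i + j)] (mod int n)"
      unfolding val_def by (intro cong_add hom yz) simp
    also have "h y + h z + t * int (i + j) = val y i + val z j"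
      by (simp add: val_def algebra_simps)
    also have "[val y i + val z j = h' u + h' w] (mod int n)"
      unfolding uw by (intro cong_add cong_sym[OF h'] yz)
    finally show "[h' (u \<otimes> w) = h' u + h' w] (mod int n)" .
  qed
  moreover have id: "y = y \<otimes> x [^] (0::nat)" if "y \<in> H" for y using that sub by auto
  then have "H \<subseteq> H'" unfolding H'_def by blast
  moreover have x': "x = \<one> \<otimes> x [^] (1::nat)" using x by simp
  then have "x \<in> H'" unfolding H'_def using one by blast
  moreover have "[h' y = h y] (mod int n)" if y: "y \<in> H" for y
    using h'[OF y, of 0] id[OF y] by (simp add: val_def)
  moreover have "[h' x = t] (mod int n)"
  proof -
    have "[h' x = h \<one> + t] (mod int n)" using h'[OF one, of 1] x' by (simp add: val_def)
    also have "[h \<one> + t = 0 + t] (mod int n)" by (intro cong_add partial_hom_one[OF H]) simp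
    finally show ?thesis by simp
  qed
  ultimately show ?thesis by blast
qed

text \<open>Let \<open>r\<close> be the least positive exponent with \<open>x [^] r \<in> H\<close>;
  it divides every such exponent, in particular \<open>n\<close>. As \<open>n / r\<close> times
  \<open>h (x [^] r)\<close> is 0 modulo \<open>n\<close>, the value \<open>h (x [^] r)\<close> is
  divisible by \<open>r\<close>, and \<open>t\<close> is the quotient.\<close>

lemma (in comm_group) partial_hom_extend_value:
  assumes H: "partial_hom n H h" and x: "x \<in> carrier G"
    and exp: "\<And>z. z \<in> carrier G \<Longrightarrow> z [^] n = \<one>" and n: "0 < n"
  shows "\<exists>t. \<forall>k::nat. x [^] k \<in> H \<longrightarrow> [h (x [^] k) = t * int k] (mod int n)"
proof -
  define r where "r = (LEAST r::nat. 0 < r \<and> x [^] r \<in> H)"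
  have one: "\<one> \<in> H" using H by (simp add: partial_hom_def)
  have ex: "0 < n \<and> x [^] n \<in> H" using exp[OF x] n one by simp
  have r: "0 < r" "x [^] r \<in> H"
    using LeastI[of "\<lambda>r. 0 < r \<and> x [^] r \<in> H", OF ex] by (auto simp: r_def)
  have dvd: "r dvd k" if k: "x [^] k \<in> H" for k :: nat
  proof (rule ccontr)
    assume "\<not> r dvd k"
    then have pos: "0 < k mod r" by (simp add: mod_greater_zero_iff_not_dvd)
    \<comment> \<open>Multiplying by the power \<open>n - 1\<close> replaces division by
      \<open>x [^] r\<close> to the \<open>k div r\<close>, which leaves
      \<open>x [^] (k mod r)\<close>.\<close>
    have "k + r * ((n - 1) * (k div r)) = k mod r + (r * (k div r) + r * ((n - 1) * (k div r)))"
      by simp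
    also have "r * (k div r) + r * ((n - 1) * (k div r)) = n * (r * (k div r))"
      using n by (cases n) (auto simp: algebra_simps)
    finally have "x [^] k \<otimes> (x [^] r) [^] ((n - 1) * (k div r)) =
        x [^] (k mod r) \<otimes> (x [^] n) [^] (r * (k div r))"
      using x by (simp add: nat_pow_mult nat_pow_pow)
    then have "x [^] (k mod r) = x [^] k \<otimes> (x [^] r) [^] ((n - 1) * (k div r))"
      using exp[OF x] x by (simp add: nat_pow_one)
    then have "x [^] (k mod r) \<in> H"
      using k partial_hom_pow[OF H r(2)] H by (auto simp: partial_hom_def)
    then have "r \<le> k mod r" unfolding r_def using pos by (intro Least_le) (simp add: r_def)
    then show False using r(1) by (meson mod_less_divisor not_le)
  qed
  have pow: "[h (x [^] (r * j)) = int j * h (x [^] r)] (mod int n)" for j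
    using partial_hom_pow[OF H r(2), of j] x by (simp add: nat_pow_pow)
  have "r dvd n" using dvd[of n] ex by blast
  then obtain m where m: "n = r * m" by (elim dvdE)
  have "[int m * h (x [^] r) = h (x [^] n)] (mod int n)" unfolding m using cong_sym[OF pow] m by simp
  also have "[h (x [^] n) = 0] (mod int n)" using partial_hom_one[OF H] exp[OF x] by simp
  finally have "int r * int m dvd int m * h (x [^] r)" by (simp add: cong_0_iff m)
  then have "int r dvd h (x [^] r)" using n m by (simp add: mult.commute)
  then obtain t where t: "h (x [^] r) = int r * t" by (elim dvdE)
  have "[h (x [^] k) = t * int k] (mod int n)" if k: "x [^] k \<in> H" for k :: nat
  proof -
    obtain j where "k = r * j" using dvd[OF k] by (elim dvdE)
    then show ?thesis using pow[of j] t by (simp add: mult_ac)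
  qed
  then show ?thesis by blast
qed

text \<open>Since \<open>g\<close> has order \<open>n\<close>, the value 1 at \<open>g\<close> is
  consistent on the trivial subgroup. A maximal domain containing \<open>g\<close> is all of
  \<open>G\<close>, as any further element could be adjoined.\<close>

lemma (in comm_group) ex_hom_to_int_mod:
  assumes fin: "finite (carrier G)" and g: "g \<in> carrier G" and n: "0 < n"
    and exp: "\<And>z. z \<in> carrier G \<Longrightarrow> z [^] n = \<one>" and ord: "ord g = n"
  obtains h where "\<And>x y. x \<in> carrier G \<Longrightarrow> y \<in> carrier G \<Longrightarrow> [h (x \<otimes> y) = h x + h y] (mod int n)"
    "[h g = 1] (mod int n)"
proof -
  define F where "F = {H. \<exists>h. partial_hom n H h \<and> g \<in> H \<and> [h g = 1] (mod int n)}"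
  have triv: "partial_hom n {\<one>} (\<lambda>_. 0)" by (auto simp: partial_hom_def)
  have t: "[0 = 1 * int k] (mod int n)" if "g [^] k \<in> {\<one>}" for k :: nat
    using that pow_eq_id[OF g] ord by (simp add: cong_0_iff cong_sym_eq[of 0])
  have "\<exists>H' h'. partial_hom n H' h' \<and> {\<one>} \<subseteq> H' \<and> g \<in> H' \<and>
      (\<forall>y\<in>{\<one>}. [h' y = 0] (mod int n)) \<and> [h' g = 1] (mod int n)"
    by (rule partial_hom_extend[OF triv g]) (fact exp n t)+
  then obtain H0 h0 where "partial_hom n H0 h0" "g \<in> H0" "[h0 g = 1] (mod int n)" by blast
  then have "H0 \<in> F" unfolding F_def by blast
  then have "F \<noteq> {}" by blast
  moreover have "finite F"
    by (rule finite_subset[of _ "Pow (carrier G)"]) (auto simp: F_def partial_hom_def fin)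
  ultimately obtain H where H: "H \<in> F" and max: "\<And>K. K \<in> F \<Longrightarrow> H \<subseteq> K \<Longrightarrow> H = K"
    using finite_has_maximal[of F] by metis
  obtain h where h: "partial_hom n H h" "g \<in> H" "[h g = 1] (mod int n)"
    using H by (auto simp: F_def)
  have "x \<in> H" if x: "x \<in> carrier G" for x
  proof -
    obtain t where t: "\<And>k::nat. x [^] k \<in> H \<Longrightarrow> [h (x [^] k) = t * int k] (mod int n)"
      using partial_hom_extend_value[OF h(1) x exp n] by blast
    have "\<exists>H' h'. partial_hom n H' h' \<and> H \<subseteq> H' \<and> x \<in> H' \<and>
        (\<forall>y\<in>H. [h' y = h y] (mod int n)) \<and> [h' x = t] (mod int n)"
      by (rule partial_hom_extend[OF h(1) x]) (fact exp n t)+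
    then obtain H' h' where H': "partial_hom n H' h'" "H \<subseteq> H'" "x \<in> H'"
      "\<And>y. y \<in> H \<Longrightarrow> [h' y = h y] (mod int n)" by blast
    have "[h' g = 1] (mod int n)" using H'(4)[OF h(2)] h(3) cong_trans by blast
    then have "H' \<in> F" unfolding F_def using H' h(2) by blast
    then show ?thesis using max H' by blast
  qed
  then show thesis using h by (intro that[of h]) (auto simp: partial_hom_def)
qed

text \<open>All element orders are powers of \<open>p\<close>, so the largest one is a multiple of
  all others.\<close>

lemma (in group) prime_power_order_exponent:
  assumes p: "prime p" and order: "order G = p ^ d" and d: "0 < d"
  obtains g e where "g \<in> carrier G" "ord g = p ^ e" "0 < e" "e \<le> d"
    "\<And>x. x \<in> carrier G \<Longrightarrow> x [^] (p ^ e) = \<one>"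
proof -
  have p1: "1 < p" using p prime_gt_1_nat by blast
  have "0 < order G" using order p1 by simp
  then have fin: "finite (carrier G)" by (rule order_gt_0_iff_finite[THEN iffD1])
  have "\<exists>b\<le>d. ord x = p ^ b" if "x \<in> carrier G" for x
    using ord_dvd_group_order[OF that] order divides_primepow_nat[OF p] by simp
  then obtain b where b: "\<And>x. x \<in> carrier G \<Longrightarrow> b x \<le> d \<and> ord x = p ^ b x" by metis
  have "Max (b ` carrier G) \<in> b ` carrier G" using fin by (intro Max_in) auto
  then obtain g where g: "g \<in> carrier G" "b g = Max (b ` carrier G)" by auto
  have max: "b x \<le> b g" if "x \<in> carrier G" for x using fin that g by simp
  have exp: "x [^] (p ^ b g) = \<one>" if x: "x \<in> carrier G" for x
    using b[OF x] max[OF x] pow_eq_id[OF x] by (simp add: le_imp_power_dvd)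
  have "0 < b g"
  proof (rule ccontr)
    assume "\<not> 0 < b g"
    then have "carrier G \<subseteq> {\<one>}" using exp by auto
    then have "order G \<le> 1" unfolding Coset.order_def by (metis card_mono card.empty card.insert empty_iff finite.emptyI finite.insertI One_nat_def)
    then show False using order one_less_power[OF p1 d] by simp
  qed
  then show thesis using that g(1) b[OF g(1)] exp by blast
qed

text \<open>The quotient by \<open>P\<close> has order \<open>w\<close>, so every
  \<open>w\<close>-th power is trivial in it.\<close>

lemma (in comm_group) pow_index_mem_subgroup:
  assumes P: "subgroup P G" and fin: "finite (carrier G)" and w: "order G = card P * w"
    and x: "x \<in> carrier G"
  shows "x [^] w \<in> P"
proof -
  interpret N: normal P G using P subgroup_imp_normal by blast
  have "card (rcosets P) * card P = order G" using lagrange[OF P] .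
  moreover have "0 < card P"
    using P fin by (metis card_gt_0_iff subgroup.subset finite_subset subgroup.one_closed empty_iff)
  ultimately have "order (G Mod P) = w"
    using w by (simp add: Coset.order_def FactGroup_def)
  moreover have "P #> x \<in> carrier (G Mod P)" using x by (simp add: carrier_FactGroup)
  ultimately have "(P #> x) [^]\<^bsub>G Mod P\<^esub> w = \<one>\<^bsub>G Mod P\<^esub>"
    using group.pow_order_eq_1[OF N.factorgroup_is_group] by blast
  then have "P #> (x [^] w) = P" using N.FactGroup_pow[OF x] by simp
  then show ?thesis using coset_join1[OF _ _ P] x subgroup.subset[OF P] by (metis nat_pow_closed)
qed

text \<open>The map \<open>x \<mapsto> x [^] w\<close> sends \<open>G\<close> into \<open>P\<close>,
  where a homomorphism with value 1 at an element of largest order is available. Since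
  \<open>w\<close> is invertible modulo \<open>p ^ e\<close>, the composition still takes the value
  1.\<close>

lemma (in comm_group) ex_hom_sylow_exponent:
  assumes fin: "finite (carrier G)" and P: "subgroup P G" and card: "card P = p ^ d"
    and p: "prime p" and d: "0 < d" and w: "order G = p ^ d * w" "coprime p w"
  obtains e and h :: "'a \<Rightarrow> nat" and z where "0 < e" "e \<le> d" "group_exponent (G\<lparr>carrier := P\<rparr>) \<le> p ^ e"
    "\<And>x y. x \<in> carrier G \<Longrightarrow> y \<in> carrier G \<Longrightarrow> [h (x \<otimes> y) = h x + h y] (mod p ^ e)"
    "z \<in> carrier G" "[h z = 1] (mod p ^ e)"
proof -
  let ?Q = "G\<lparr>carrier := P\<rparr>"
  interpret Q: comm_group ?Q
    by (rule group.group_comm_groupI[OF subgroup_imp_group[OF P]])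
      (use subgroup.subset[OF P] in \<open>auto intro: m_comm\<close>)
  have pow: "x [^]\<^bsub>?Q\<^esub> (k::nat) = x [^] k" for x k using nat_pow_consistent[of x k P] by simp
  have sub: "P \<subseteq> carrier G" using P by (rule subgroup.subset)
  obtain g e where ge: "g \<in> carrier ?Q" "Q.ord g = p ^ e" "0 < e" "e \<le> d"
    and exp: "\<And>x. x \<in> carrier ?Q \<Longrightarrow> x [^]\<^bsub>?Q\<^esub> (p ^ e) = \<one>\<^bsub>?Q\<^esub>"
    by (rule Q.prime_power_order_exponent[OF p _ d]) (auto simp: Coset.order_def card)
  let ?n = "p ^ e"
  have n: "0 < ?n" using prime_gt_0_nat[OF p] by simp
  have finP: "finite (carrier ?Q)" using fin sub finite_subset by auto
  obtain h where h: "\<And>x y. x \<in> P \<Longrightarrow> y \<in> P \<Longrightarrow> [h (x \<otimes> y) = h x + h y] (mod int ?n)"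
    and hg: "[h g = 1] (mod int ?n)"
    using Q.ex_hom_to_int_mod[OF finP ge(1) n exp ge(2)] by auto
  have mem: "x [^] w \<in> P" if "x \<in> carrier G" for x
    using pow_index_mem_subgroup[OF P fin _ that] w card by simp
  define h' where "h' = (\<lambda>x. nat (h (x [^] w) mod int ?n))"
  have h': "[int (h' x) = h (x [^] w)] (mod int ?n)" for x
    using n by (simp add: h'_def cong_def)
  have hom': "[h' (x \<otimes> y) = h' x + h' y] (mod ?n)" if xy: "x \<in> carrier G" "y \<in> carrier G" for x y
  proof -
    have "[int (h' (x \<otimes> y)) = h (x [^] w \<otimes> y [^] w)] (mod int ?n)"
      using h'[of "x \<otimes> y"] xy by (simp add: nat_pow_distrib)
    also have "[h (x [^] w \<otimes> y [^] w) = h (x [^] w) + h (y [^] w)] (mod int ?n)"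
      by (intro h mem xy)
    also have "[h (x [^] w) + h (y [^] w) = int (h' x) + int (h' y)] (mod int ?n)"
      by (intro cong_add cong_sym[OF h'])
    finally show ?thesis by (simp flip: cong_int_iff)
  qed
  obtain w' where w': "[w * w' = 1] (mod ?n)"
    using cong_solve_coprime_nat[of w ?n] w(2) by (auto simp: coprime_commute)
  let ?z = "g [^] w'"
  have gG: "g \<in> carrier G" using ge(1) sub by auto
  have hP: "Q.partial_hom ?n P h"
    using subgroup.one_closed[OF P] subgroup.m_closed[OF P] h by (auto simp: Q.partial_hom_def)
  have "?z [^] w = g [^]\<^bsub>?Q\<^esub> (w * w')" using gG by (simp add: nat_pow_pow pow mult.commute)
  then have "[int (h' ?z) = h (g [^]\<^bsub>?Q\<^esub> (w * w'))] (mod int ?n)" using h'[of ?z] by simp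
  also have "[h (g [^]\<^bsub>?Q\<^esub> (w * w')) = int (w * w') * h g] (mod int ?n)"
    using Q.partial_hom_pow[OF hP, of g "w * w'"] ge(1) by simp
  also have "[int (w * w') * h g = int 1 * 1] (mod int ?n)"
    by (intro cong_mult hg) (use w' in \<open>simp only: cong_int_iff\<close>)
  finally have z: "[h' ?z = 1] (mod ?n)" by (simp flip: cong_int_iff)
  have "group_exponent ?Q \<le> ?n"
    unfolding group_exponent_def using n exp by (intro Least_le) auto
  then show thesis using that[of e h' ?z] ge hom' z gG by simp
qed

section \<open>The image of the group ring\<close>

text \<open>\<open>h\<close> has natural values so that they can serve as exponents of the variable;
  \<open>z\<close> witnesses that \<open>h\<close> is onto modulo \<open>n\<close>.\<close>

locale cyclic_quotient = comm_group G + prime_power_cyclotomic p a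
  for G :: "('a, 'b) monoid_scheme" (structure) and p a :: nat +
  fixes h :: "'a \<Rightarrow> nat" and z :: 'a
  assumes fin: "finite (carrier G)"
    and hom: "x \<in> carrier G \<Longrightarrow> y \<in> carrier G \<Longrightarrow> [h (x \<otimes> y) = h x + h y] (mod n)"
    and z: "z \<in> carrier G" "[h z = 1] (mod n)"
begin

text \<open>Read modulo \<open>Phi\<close>, this is the ring homomorphism on the group ring induced
  by the character that sends \<open>x\<close> to the \<open>h x\<close>-th power of a root of
  unity.\<close>

definition poly_image :: "'a group_ring \<Rightarrow> int poly" where
  "poly_image f = (\<Sum>x\<in>carrier G. [:f x:] * X_pow (h x))"

lemma poly_image_mult: "poly_image (gr_mult G f g) \<sim> poly_image f * poly_image g"
proof -
  let ?S = "carrier G \<times> carrier G"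
  have "poly_image (gr_mult G f g) = (\<Sum>x\<in>carrier G.
      \<Sum>u\<in>{u \<in> ?S. fst u \<otimes> snd u = x}. [:f (fst u) * g (snd u):] * X_pow (h (fst u \<otimes> snd u)))"
  proof -
    have "[:gr_mult G f g x:] * X_pow (h x) =
        (\<Sum>u\<in>{u \<in> ?S. fst u \<otimes> snd u = x}. [:f (fst u) * g (snd u):] * X_pow (h (fst u \<otimes> snd u)))" for x
    proof -
      have "{(y, w). y \<in> carrier G \<and> w \<in> carrier G \<and> y \<otimes> w = x} = {u \<in> ?S. fst u \<otimes> snd u = x}"
        by auto
      then have "[:gr_mult G f g x:] = (\<Sum>u\<in>{u \<in> ?S. fst u \<otimes> snd u = x}. [:f (fst u) * g (snd u):])"
        by (simp add: gr_mult_def case_prod_beta sum_to_poly)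
      then show ?thesis by (simp add: sum_distrib_right)
    qed
    then show ?thesis by (simp add: poly_image_def)
  qed
  also have "\<dots> = (\<Sum>u\<in>?S. [:f (fst u) * g (snd u):] * X_pow (h (fst u \<otimes> snd u)))"
    using fin by (intro sum.group) auto
  also have "\<dots> \<sim> (\<Sum>u\<in>?S. [:f (fst u) * g (snd u):] * X_pow (h (fst u) + h (snd u)))"
    by (intro cong2_sum cong2_mult_left X_pow_cong hom) auto
  also have "\<dots> = (\<Sum>u\<in>?S. ([:f (fst u):] * X_pow (h (fst u))) * ([:g (snd u):] * X_pow (h (snd u))))"
    by (simp add: mult_monom ac_simps)
  also have "\<dots> = poly_image f * poly_image g"
    unfolding poly_image_def sum_product by (simp add: sum.cartesian_product case_prod_beta)
  finally show ?thesis .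
qed

lemma hom_pow: "[h (z [^] k) = k] (mod n)" for k :: nat
proof (induction k)
  case 0
  have "[h \<one> + h \<one> = h \<one> + 0] (mod n)" using hom[of \<one> \<one>] by (simp add: cong_sym_eq)
  then show ?case by (simp only: cong_add_lcancel_nat nat_pow_0)
next
  case (Suc k)
  have "[h (z [^] k \<otimes> z) = h (z [^] k) + h z] (mod n)" by (intro hom nat_pow_closed z)
  also have "[h (z [^] k) + h z = k + 1] (mod n)" by (intro cong_add Suc z)
  finally show ?case by simp
qed

lemma hom_one: "[h \<one> = 0] (mod n)"
  using hom_pow[of 0] by simp

definition fibre :: "nat \<Rightarrow> 'a set" where
  "fibre i = {x \<in> carrier G. h x mod n = i}"

lemma finite_fibre [simp]: "finite (fibre i)"
  using fin by (simp add: fibre_def)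

text \<open>Multiplication by \<open>z [^] k\<close> injects one fibre into the other. Used in both
  directions, this shows that all fibres have the same size.\<close>

lemma card_fibre_le: "card (fibre i) \<le> card (fibre ((i + k) mod n))"
proof (rule card_inj_on_le)
  show "inj_on (\<lambda>x. x \<otimes> z [^] k) (fibre i)"
    using z by (auto simp: inj_on_def fibre_def)
  show "(\<lambda>x. x \<otimes> z [^] k) ` fibre i \<subseteq> fibre ((i + k) mod n)"
  proof
    fix y assume "y \<in> (\<lambda>x. x \<otimes> z [^] k) ` fibre i"
    then obtain x where x: "x \<in> carrier G" "h x mod n = i" "y = x \<otimes> z [^] k"
      by (auto simp: fibre_def)
    have "[h y = h x + h (z [^] k)] (mod n)" unfolding x(3) by (intro hom x nat_pow_closed z)
    also have "[h x + h (z [^] k) = i + k] (mod n)"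
      using x(2) by (intro cong_add hom_pow) (auto simp: cong_def)
    finally show "y \<in> fibre ((i + k) mod n)" using x z by (auto simp: fibre_def cong_def)
  qed
qed simp

lemma card_fibre:
  assumes "i < n"
  shows "n * card (fibre i) = order G"
proof -
  have eq: "card (fibre j) = card (fibre i)" if "j < n" for j
    \<comment> \<open>Adding \<open>n\<close> before subtracting keeps the natural difference from
      being truncated and does not change the residue.\<close>
    using card_fibre_le[of i "j + n - i"] card_fibre_le[of j "i + n - j"] assms that by simp
  have "order G = (\<Sum>x\<in>carrier G. 1)" by (simp add: Coset.order_def)
  also have "\<dots> = (\<Sum>j<n. \<Sum>x\<in>fibre j. 1)"
    unfolding fibre_def using fin n_gt_1 by (intro sum.group[symmetric]) auto
  also have "\<dots> = (\<Sum>j<n. card (fibre i))" using eq by simp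
  finally show ?thesis by simp
qed

lemma poly_image_eqv: "poly_image f \<sim> (\<Sum>i<n. monom (\<Sum>x\<in>fibre i. f x) i)"
proof -
  have "poly_image f \<sim> (\<Sum>x\<in>carrier G. [:f x:] * X_pow (h x mod n))"
    unfolding poly_image_def by (intro cong2_sum cong2_mult_left X_pow_cong) (simp add: cong_def)
  also have "\<dots> = (\<Sum>i<n. \<Sum>x\<in>fibre i. [:f x:] * X_pow (h x mod n))"
    unfolding fibre_def using fin n_gt_1 by (intro sum.group[symmetric]) auto
  also have "\<dots> = (\<Sum>i<n. monom (\<Sum>x\<in>fibre i. f x) i)"
  proof (rule sum.cong[OF refl])
    fix i
    have "(\<Sum>x\<in>fibre i. [:f x:] * X_pow (h x mod n)) = (\<Sum>x\<in>fibre i. monom (f x) i)"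
      by (intro sum.cong) (auto simp: fibre_def smult_monom)
    then show "(\<Sum>x\<in>fibre i. [:f x:] * X_pow (h x mod n)) = monom (\<Sum>x\<in>fibre i. f x) i"
      by (simp add: poly_eq_iff coeff_sum)
  qed
  finally show ?thesis .
qed

text \<open>A nontrivial character annihilates the sum over the group: equal fibres give a multiple
  of the sum of all \<open>X_pow i\<close> with \<open>i < n\<close>.\<close>

lemma poly_image_one: "poly_image (\<lambda>_. 1) \<sim> 0"
proof -
  have "int (card (fibre i)) = int (order G div n)" if "i < n" for i
    using card_fibre[OF that] n_gt_1 by (metis nonzero_mult_div_cancel_left not_less_zero)
  then have "poly_image (\<lambda>_. 1) \<sim> (\<Sum>i<n. monom (int (order G div n)) i)"
    using poly_image_eqv[of "\<lambda>_. 1"] by simp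
  also have "\<dots> = [:int (order G div n):] * (\<Sum>i<n. X_pow i)"
    by (simp add: sum_distrib_left smult_monom)
  also have "\<dots> \<sim> [:int (order G div n):] * 0" by (rule cong2_mult_left[OF sum_X_pow_eqv_0])
  finally show ?thesis by simp
qed

lemma poly_image_delta_one: "poly_image (gr_of \<one>) \<sim> 1"
proof -
  have "poly_image (gr_of \<one>) = (\<Sum>x\<in>carrier G. if x = \<one> then X_pow (h \<one>) else 0)"
    unfolding poly_image_def gr_of_def by (intro sum.cong) (auto simp: pCons_one)
  also have "\<dots> = X_pow (h \<one>)" using fin by simp
  also have "\<dots> \<sim> X_pow 0" by (rule X_pow_cong[OF hom_one])
  finally show ?thesis by simp
qed

text \<open>Collected by residues, the coefficients lie between 0 and the common fibre size
  \<open>order G div n\<close>, which is below \<open>Q\<close>.\<close>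

lemma poly_image_0_1_eqv_0:
  assumes "\<And>x. x \<in> carrier G \<Longrightarrow> 0 \<le> f x \<and> f x \<le> 1" and "order G < n * Q"
    and "cong2 (of_nat Q) Phi (poly_image f) 0"
  shows "poly_image f \<sim> 0"
proof -
  define c where "c = (\<lambda>i. \<Sum>x\<in>fibre i. f x)"
  define u where "u = order G div n"
  have card_le: "card (fibre i) \<le> u" for i
  proof (cases "i < n")
    case True
    then show ?thesis using card_fibre[OF True] n_gt_1
      by (metis le_refl nonzero_mult_div_cancel_left not_less_zero u_def)
  next
    case False
    then have "fibre i = {}" using n_gt_1 by (auto simp: fibre_def)
    then show ?thesis by simp
  qed
  have "0 \<le> c i \<and> c i \<le> int u" for i
  proof
    show "0 \<le> c i" unfolding c_def using assms(1) by (intro sum_nonneg) (auto simp: fibre_def)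
    have "c i \<le> (\<Sum>x\<in>fibre i. 1)" unfolding c_def
      using assms(1) by (intro sum_mono) (auto simp: fibre_def)
    then show "c i \<le> int u" using card_le[of i] by simp
  qed
  moreover have "int u < int Q" unfolding u_def using assms(2) n_gt_1
    by (simp add: div_less_iff_less_mult mult.commute)
  moreover have img: "poly_image f \<sim> (\<Sum>i<n. monom (c i) i)"
    unfolding c_def by (rule poly_image_eqv)
  have "cong2 (of_nat Q) Phi (\<Sum>i<n. monom (c i) i) 0"
    by (rule cong2_trans[OF cong2_sym[OF cong2_weaken_left[OF img]] assms(3)])
  ultimately have "(\<Sum>i<n. monom (c i) i) \<sim> 0" by (rule small_coeffs_eqv_0)
  with img show ?thesis by (rule cong2_trans)
qed

end

section \<open>Bounding the group order through the equation of the family\<close>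

locale inert_cyclic_quotient = cyclic_quotient + inert_prime
begin

lemma cong2_power_le:
  assumes "cong2 (of_nat (q ^ i)) Phi A 0" and "j \<le> i"
  shows "cong2 (of_nat (q ^ j)) Phi A 0"
proof -
  obtain U W where "A - 0 = of_nat (q ^ i) * U + Phi * W" using assms(1) by (auto simp: cong2_def)
  also have "of_nat (q ^ i) * U = of_nat (q ^ j) * (of_nat (q ^ (i - j)) * U)"
    using assms(2) by (simp flip: mult.assoc power_add)
  finally show ?thesis unfolding cong2_def by blast
qed

lemma const_product_bound:
  assumes f: "\<And>x. x \<in> carrier G \<Longrightarrow> 0 \<le> f x \<and> f x \<le> 1"
    and g: "\<And>x. x \<in> carrier G \<Longrightarrow> 0 \<le> g x \<and> g x \<le> 1"
    and prod: "poly_image f * poly_image g \<sim> [:C:]" and "C \<noteq> 0" and "int (q ^ r) dvd C"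
  shows "n * q ^ ((r + 1) div 2) \<le> order G"
proof (rule ccontr)
  let ?c = "(r + 1) div 2"
  assume "\<not> ?thesis"
  then have less: "order G < n * q ^ ?c" by simp
  obtain k where "C = int (q ^ r) * k" using assms(5) by (elim dvdE)
  then have "[:C:] - 0 = of_nat (q ^ r) * [:k:] + Phi * 0" by (simp add: of_nat_poly)
  then have "cong2 (of_nat (q ^ r)) Phi [:C:] 0" unfolding cong2_def by blast
  then have "cong2 (of_nat (q ^ r)) Phi (poly_image f * poly_image g) 0"
    by (rule cong2_trans[OF cong2_weaken_left[OF prod]])
  then obtain i j where ij: "i + j = r" "cong2 (of_nat (q ^ i)) Phi (poly_image f) 0"
    "cong2 (of_nat (q ^ j)) Phi (poly_image g) 0"
    using inert_mult_power by blast
  \<comment> \<open>\<open>?c\<close> is half of \<open>r\<close> rounded up, so one of two summands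
    of \<open>r\<close> reaches it.\<close>
  have "?c \<le> i \<or> ?c \<le> j" using ij(1) by linarith
  then have "poly_image f \<sim> 0 \<or> poly_image g \<sim> 0"
    using poly_image_0_1_eqv_0[of f, OF f less] poly_image_0_1_eqv_0[of g, OF g less]
      cong2_power_le ij(2,3) by blast
  then have "poly_image f * poly_image g \<sim> 0"
  proof
    assume "poly_image f \<sim> 0"
    from cong2_mult_left[OF this, of "poly_image g"] show ?thesis by (simp add: mult.commute)
  next
    assume "poly_image g \<sim> 0"
    from cong2_mult_left[OF this, of "poly_image f"] show ?thesis by simp
  qed
  then have "[:C:] \<sim> 0" using cong2_trans[OF cong2_sym[OF prod]] by blast
  then have "[:C:] = 0" using degree_Phi_pos by (intro eqv_0_degree_less) auto
  then show False using \<open>C \<noteq> 0\<close> by simp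
qed

lemma SEDF_bound:
  assumes sedf: "SEDF G v m k l D" and dvd: "q ^ r dvd l"
  shows "n * q ^ ((r + 1) div 2) \<le> order G"
proof -
  have m: "1 \<in> {1..m}" and l: "l \<ge> 1"
    and D: "\<And>i. i \<in> {1..m} \<Longrightarrow> D i \<subseteq> carrier G" and disj: "disjoint_family_on D {1..m}"
    using sedf by (auto simp: SEDF_def)
  let ?f = "gr_set (D 1)" and ?g = "\<lambda>x. \<Sum>i\<in>{1..m} - {1}. gr_set_inv G (D i) x"
  have eq: "gr_mult G ?f ?g = (\<lambda>x. int l * (gr_set (carrier G) x - gr_of \<one> x))"
    using sedf m unfolding SEDF_def by blast
  have finD: "finite (D i)" if "i \<in> {1..m}" for i using D[OF that] fin finite_subset by blast
  have gr_set: "gr_set A x = (if x \<in> A then 1 else 0)" if "finite A" for A :: "'a set" and x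
    using that by (simp add: gr_set_def gr_of_def)
  have gr_set_inv: "gr_set_inv G (D i) x = (if inv x \<in> D i then 1 else 0)"
    if "i \<in> {1..m}" "x \<in> carrier G" for i x
  proof -
    have "(x = inv y) = (y = inv x)" if "y \<in> D i" for y
      using D[OF \<open>i \<in> {1..m}\<close>] that \<open>x \<in> carrier G\<close> by auto
    then have "gr_set_inv G (D i) x = (\<Sum>y\<in>D i. if y = inv x then 1 else 0)"
      unfolding gr_set_inv_def gr_of_def by (intro sum.cong) auto
    then show ?thesis using finD[OF that(1)] by simp
  qed
  have f: "0 \<le> ?f x \<and> ?f x \<le> 1" for x using gr_set[OF finD[OF m]] by simp
  have g: "0 \<le> ?g x \<and> ?g x \<le> 1" if x: "x \<in> carrier G" for x
  \<comment> \<open>The sets \<open>D i\<close> are disjoint, so \<open>inv x\<close> lies in at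
    most one of them and at most one summand is 1.\<close>
  proof (cases "\<exists>j\<in>{1..m} - {1}. inv x \<in> D j")
    case True
    then obtain j where j: "j \<in> {1..m} - {1}" "inv x \<in> D j" by blast
    have "?g x = (\<Sum>i\<in>{1..m} - {1}. if i = j then 1 else 0)"
    proof (rule sum.cong[OF refl])
      fix i assume i: "i \<in> {1..m} - {1}"
      have "inv x \<notin> D i" if "i \<noteq> j"
        using disjoint_family_onD[OF disj _ _ that] i j by blast
      then show "gr_set_inv G (D i) x = (if i = j then 1 else 0)"
        using gr_set_inv[OF _ x, of i] i j(2) by auto
    qed
    then show ?thesis using j(1) by simp
  next
    case False
    then have "?g x = 0" using gr_set_inv[OF _ x] by (intro sum.neutral) auto
    then show ?thesis by simp
  qed
  have "poly_image ?f * poly_image ?g \<sim> poly_image (gr_mult G ?f ?g)"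
    by (rule cong2_sym[OF poly_image_mult])
  \<comment> \<open>The image of the whole group vanishes and that of the identity is 1, so the
    product of the images becomes \<open>- int l\<close>.\<close>
  also have "\<dots> = [:int l:] * (poly_image (\<lambda>_. 1) - poly_image (gr_of \<one>))"
    unfolding eq poly_image_def sum_subtractf[symmetric] sum_distrib_left
    by (intro sum.cong)
      (auto simp: gr_set[OF fin] smult_diff_right smult_diff_left right_diff_distrib mult.commute)
  also have "\<dots> \<sim> [:int l:] * (0 - 1)"
    by (intro cong2_mult_left cong2_diff poly_image_one poly_image_delta_one)
  also have "\<dots> = [:- int l:]" by simp
  finally have prod: "poly_image ?f * poly_image ?g \<sim> [:- int l:]" .
  have "int (q ^ r) dvd - int l" using dvd by (simp only: dvd_minus_iff of_nat_dvd_iff)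
  moreover have "- int l \<noteq> 0" using l by simp
  ultimately show ?thesis by (intro const_product_bound[OF f g prod])
qed

end

section \<open>From the Sylow subgroup to the bound on its exponent\<close>

theorem theorem4p2:
  fixes G :: "('a, 'b) monoid_scheme"
    and v m k l p q d f :: nat
    and Gp :: "'a set"
  assumes "comm_group G" and "finite (carrier G)" and "order G = v"
    and "\<exists>D. SEDF G v m k l D"
    and "prime p" and "prime q"
    and "d > 0" and "f > 0"
    and "exactly_divides p d v"
    and "exactly_divides q f l"
    and "residue_primroot (p ^ d) q"
    and "sylow_subgroup G p Gp"
  shows "real (group_exponent (G\<lparr>carrier := Gp\<rparr>)) \<le> real v / real q ^ nat \<lceil>real f / 2\<rceil>"
proof -
  interpret comm_group G by fact
  obtain D where D: "SEDF G v m k l D" using assms(4) by blast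
  have "multiplicity p v = d"
    using assms(9) by (intro multiplicity_eqI) (auto simp: exactly_divides_def)
  then have Gp: "subgroup Gp G" "card Gp = p ^ d"
    using assms(12) by (auto simp: sylow_subgroup_def assms(3))
  obtain w where w: "v = p ^ d * w" using assms(9) by (auto simp: exactly_divides_def)
  have "\<not> p dvd w" using assms(9) by (auto simp: exactly_divides_def w)
  then have "coprime p w" using assms(5) prime_imp_coprime by blast
  with w obtain e and h :: "'a \<Rightarrow> nat" and z where e: "0 < e" "e \<le> d"
    and exp: "group_exponent (G\<lparr>carrier := Gp\<rparr>) \<le> p ^ e"
    and h: "\<And>x y. x \<in> carrier G \<Longrightarrow> y \<in> carrier G \<Longrightarrow> [h (x \<otimes>\<^bsub>G\<^esub> y) = h x + h y] (mod p ^ e)"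
    and z: "z \<in> carrier G" "[h z = 1] (mod p ^ e)"
    using ex_hom_sylow_exponent[OF assms(2) Gp assms(5,7)] assms(3) by metis
  obtain a where a: "e = Suc a" using e(1) gr0_conv_Suc by blast
  interpret prime_power_cyclotomic p a by standard (fact assms(5))
  have n: "n = p ^ e" unfolding n_eq a ..
  interpret inert_cyclic_quotient G p a h z q
  proof
    show "residue_primroot n q"
      unfolding n by (rule residue_primroot_prime_power_le[OF assms(11,5) e])
  qed (use assms(2,6) h z in \<open>auto simp: n\<close>)
  have "q ^ f dvd l" using assms(10) by (simp add: exactly_divides_def)
  then have "n * q ^ ((f + 1) div 2) \<le> v" using SEDF_bound[OF D] assms(3) by simp
  moreover have c: "nat \<lceil>real f / 2\<rceil> = (f + 1) div 2" by linarith
  ultimately have "group_exponent (G\<lparr>carrier := Gp\<rparr>) * q ^ nat \<lceil>real f / 2\<rceil> \<le> v"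
    unfolding c using exp n mult_le_mono1 order_trans by metis
  then have "real (group_exponent (G\<lparr>carrier := Gp\<rparr>)) * real q ^ nat \<lceil>real f / 2\<rceil> \<le> real v"
    by (simp flip: of_nat_mult of_nat_power)
  then show ?thesis using prime_gt_0_nat[OF assms(6)] by (simp add: pos_le_divide_eq)
qed

end
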